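(* Let $q$ be a prime power and $r\geq 1$. Let $M$ be a rank-$r$ matroid representable over $GF(q)$ such that $\mathrm{si}(M)$ is not isomorphic to $P_r=PG(r-1,q)$. Then $$\frac{|E(M)|}{g^\ast(M)}\geq \frac{q}{q-1}.$$ Moreover, equality holds if and only if $M$ is loopless and, for a fixed embedding of $\mathrm{si}(M)$ as a restriction of $P_r$ (so that the ground set of $\mathrm{si}(M)$ is a subset of the point set of $P_r$, each point of $\mathrm{si}(M)$ corresponding to a parallel class of $M$): (i) the complement of $E(\mathrm{si}(M))$ in $P_r$ (i.e. the restriction of $P_r$ to the points not in $\mathrm{si}(M)$) is isomorphic to $P_k=PG(k-1,q)$ for some $k$ with $1\leq k<r$; (ii) if $P$ is a restriction of $P_r$ isomorphic to $P_{k+1}=PG(k,q)$ that contains the complement of $\mathrm{si}(M)$ in $P_r$, then the parallel classes of $M$ corresponding to the points of $\mathrm{si}(M)$ lying in $E(P)$ all have the same size; and (iii) $|E(N)|\geq (q-1)\,|E(M)-E(N)|$ for every restriction $N$ of $M$ whose simplification is isomorphic to $A_r=AG(r-1,q)$.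
   Context: For a matroid $M$ of nonzero rank, the cogirth $g^\ast(M)$ is the size of a smallest cocircuit of $M$. $\mathrm{si}(M)$ denotes the simplification of $M$. $P_r$ denotes the projective geometry $PG(r-1,q)$ and $A_r$ the affine geometry $AG(r-1,q)$, over the same field $GF(q)$.
   Formalization: In (iii), N ranges only over restrictions of M to unions of whole parallel classes; with partial classes the equivalence fails (q=r=2, U_{2,2} with each element tripled, N a transversal). *)

theory Defs
  imports
    Main
    "HOL-Library.Cardinality"
    "HOL-Library.Function_Algebras"
    "HOL-Number_Theory.Prime_Powers"
    Complex_Main
begin

section \<open>Finite matroids\<close>

record 'a mstruct =
  ground :: "'a set"
  indep :: "'a set \<Rightarrow> bool"

locale matroid =
  fixes M :: "'a mstruct"
  assumes finite_ground: "finite (ground M)"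
    and indep_subset_ground: "indep M X \<Longrightarrow> X \<subseteq> ground M"
    and indep_empty: "indep M {}"
    and indep_subset: "indep M X \<Longrightarrow> Y \<subseteq> X \<Longrightarrow> indep M Y"
    and augment: "indep M X \<Longrightarrow> indep M Y \<Longrightarrow> card X < card Y
      \<Longrightarrow> \<exists>y\<in>Y - X. indep M (insert y X)"

definition mbasis :: "'a mstruct \<Rightarrow> 'a set \<Rightarrow> bool" where
  "mbasis M B \<longleftrightarrow> indep M B \<and> (\<forall>X. indep M X \<longrightarrow> B \<subseteq> X \<longrightarrow> X = B)"

definition mrank :: "'a mstruct \<Rightarrow> nat" where
  "mrank M = Max (card ` {X. indep M X})"

definition mcircuit :: "'a mstruct \<Rightarrow> 'a set \<Rightarrow> bool" where
  "mcircuit M C \<longleftrightarrow> C \<subseteq> ground M \<and> \<not> indep M C \<and> (\<forall>X. X \<subset> C \<longrightarrow> indep M X)"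

definition mdual :: "'a mstruct \<Rightarrow> 'a mstruct" where
  "mdual M = \<lparr>ground = ground M,
     indep = (\<lambda>X. X \<subseteq> ground M \<and> (\<exists>B. mbasis M B \<and> X \<inter> B = {}))\<rparr>"

definition mcocircuit :: "'a mstruct \<Rightarrow> 'a set \<Rightarrow> bool" where
  "mcocircuit M C \<longleftrightarrow> mcircuit (mdual M) C"

definition cogirth :: "'a mstruct \<Rightarrow> nat" where
  "cogirth M = Min (card ` {C. mcocircuit M C})"

definition mrestrict :: "'a mstruct \<Rightarrow> 'a set \<Rightarrow> 'a mstruct" where
  "mrestrict M X = \<lparr>ground = ground M \<inter> X, indep = (\<lambda>Y. indep M Y \<and> Y \<subseteq> X)\<rparr>"

definition iso_map :: "('a \<Rightarrow> 'b) \<Rightarrow> 'a mstruct \<Rightarrow> 'b mstruct \<Rightarrow> bool" where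
  "iso_map f M N \<longleftrightarrow> bij_betw f (ground M) (ground N) \<and>
     (\<forall>X\<subseteq>ground M. indep M X \<longleftrightarrow> indep N (f ` X))"

definition miso :: "'a mstruct \<Rightarrow> 'b mstruct \<Rightarrow> bool" where
  "miso M N \<longleftrightarrow> (\<exists>f. iso_map f M N)"

definition membedding :: "('a \<Rightarrow> 'b) \<Rightarrow> 'a mstruct \<Rightarrow> 'b mstruct \<Rightarrow> bool" where
  "membedding f M N \<longleftrightarrow> f ` ground M \<subseteq> ground N \<and> iso_map f M (mrestrict N (f ` ground M))"


section \<open>Loops, parallel classes and simplification\<close>

definition mloop :: "'a mstruct \<Rightarrow> 'a \<Rightarrow> bool" where
  "mloop M e \<longleftrightarrow> mcircuit M {e}"

definition loopless :: "'a mstruct \<Rightarrow> bool" where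
  "loopless M \<longleftrightarrow> (\<forall>e\<in>ground M. \<not> mloop M e)"

definition parallel :: "'a mstruct \<Rightarrow> 'a \<Rightarrow> 'a \<Rightarrow> bool" where
  "parallel M e f \<longleftrightarrow> e \<in> ground M \<and> f \<in> ground M \<and> \<not> mloop M e \<and> \<not> mloop M f \<and>
     (e = f \<or> mcircuit M {e, f})"

definition parallel_classes :: "'a mstruct \<Rightarrow> 'a set set" where
  "parallel_classes M = {{f. parallel M e f} | e. e \<in> ground M \<and> \<not> mloop M e}"

text \<open>The points of the simplification are the parallel classes themselves; a set of classes is
  independent if a system of representatives is.\<close>

definition si :: "'a mstruct \<Rightarrow> 'a set mstruct" where
  "si M = \<lparr>ground = parallel_classes M,
     indep = (\<lambda>\<C>. \<C> \<subseteq> parallel_classes M \<and>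
       (\<exists>rep. (\<forall>C\<in>\<C>. rep C \<in> C) \<and> indep M (rep ` \<C>)))\<rparr>"


section \<open>Vector matroids and finite geometries\<close>

text \<open>The space of \<open>n\<close>-tuples over a field is the subspace of the sequences that vanish from
  index \<open>n\<close> on.\<close>

definition fscale :: "'f::field \<Rightarrow> (nat \<Rightarrow> 'f) \<Rightarrow> (nat \<Rightarrow> 'f)" where
  "fscale c v = (\<lambda>i. c * v i)"

global_interpretation fvec: vector_space "fscale :: 'f::field \<Rightarrow> _"
  by unfold_locales (auto simp: fscale_def fun_eq_iff algebra_simps)

definition tuples :: "nat \<Rightarrow> (nat \<Rightarrow> 'f::field) set" where
  "tuples n = {v. \<forall>i\<ge>n. v i = 0}"

definition vmatroid :: "nat \<Rightarrow> (nat \<Rightarrow> 'f::field) mstruct" where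
  "vmatroid n = \<lparr>ground = tuples n, indep = (\<lambda>X. X \<subseteq> tuples n \<and> fvec.independent X)\<rparr>"

text \<open>\<open>M\<close> is representable if it is the column matroid of a matrix with entries in the field;
  columns may vanish or coincide.\<close>

definition representable_over :: "'f::field itself \<Rightarrow> 'a mstruct \<Rightarrow> bool" where
  "representable_over _ M \<longleftrightarrow> (\<exists>n. \<exists>\<psi> :: 'a \<Rightarrow> nat \<Rightarrow> 'f. \<psi> ` ground M \<subseteq> tuples n \<and>
     (\<forall>X\<subseteq>ground M. indep M X \<longleftrightarrow> inj_on \<psi> X \<and> fvec.independent (\<psi> ` X)))"

text \<open>\<open>PG n\<close> is the projective geometry of rank \<open>n\<close>, i.e. of projective dimension \<open>n - 1\<close>. Its
  points are the one-dimensional subspaces of the space of \<open>n\<close>-tuples, with the zero vector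
  removed.\<close>

definition PG :: "nat \<Rightarrow> (nat \<Rightarrow> 'f::field) set mstruct" where
  "PG n = si (vmatroid n)"

text \<open>The affine geometry of rank \<open>n \<ge> 1\<close>: the hyperplane on which coordinate \<open>0\<close> vanishes is
  deleted from \<open>PG n\<close>.\<close>

definition AG :: "nat \<Rightarrow> (nat \<Rightarrow> 'f::field) set mstruct" where
  "AG n = mrestrict (PG n) {p. \<forall>v\<in>p. v 0 \<noteq> 0}"

end

theory Submission imports Defs begin

text \<open>
  Embed the simplification of \<open>M\<close> in \<open>P\<^sub>r\<close> and give each vector of \<open>GF(q)\<^sup>r\<close> the size of the parallel
  class on its line as weight. The cogirth of \<open>M\<close> is the least weight of the complement of a linear
  hyperplane. A point \<open>p\<close> of weight zero exists since the simplification is not \<open>P\<^sub>r\<close>; averaged over the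
  hyperplanes that avoid \<open>p\<close>, the complement has weight \<open>(q - 1) / q\<close> of the total, whence the bound.

  In the case of equality every hyperplane that avoids some point of weight zero attains the average.
  The weights can be recovered from the weights of the hyperplanes by Radon inversion, and only the
  hyperplanes containing all points of weight zero contribute, so the weights are invariant
  under translation by vectors of weight zero. This gives (i) and (ii). Conversely the
  invariance forces equality on all hyperplanes not containing the missing flat; on the others
  the required inequality is (iii).
\<close>

section \<open>Families of vectors over a finite field\<close>

text \<open>Weights sit on vectors and hyperplanes are given by functionals \<open>dot r u\<close>,
  so every point and every hyperplane occurs q - 1 times; in exchange vectors can be added, which
  translation invariance needs. The averaging rests on one count: for a fixed nonzero x, a nonzero v
  off the line of x is killed by exactly one q-th of the functionals that kill x. Summing hyperplane
  weights over these functionals thus gives a constant plus a multiple of the weight of x, and for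
  weight zero only the constant remains. Two obstacles shape the rest. The embedding is arbitrary
  and need not come from the given representation, so a representation is rebuilt from it. And the
  isomorphisms with projective and affine geometries are matroid isomorphisms that need not be
  induced by linear maps; subspaces are therefore recognised from what every isomorphism preserves:
  rank and number of points in the projective case, number of points and collinearity in the affine
  case.\<close>

text \<open>Independence of the image alone would forget repetitions; injectivity on the index set
  makes two equal columns dependent, as parallel elements must be.\<close>

definition indep_family :: "('a \<Rightarrow> nat \<Rightarrow> 'f::field) \<Rightarrow> 'a set \<Rightarrow> bool" where
  "indep_family \<psi> X \<longleftrightarrow> inj_on \<psi> X \<and> fvec.independent (\<psi> ` X)"

lemma indep_family_iff:
  assumes "finite X"
  shows "indep_family \<psi> X \<longleftrightarrow>
    (\<forall>c. (\<Sum>x\<in>X. fscale (c x) (\<psi> x)) = 0 \<longrightarrow> (\<forall>x\<in>X. c x = 0))" (is "_ \<longleftrightarrow> ?R")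
proof
  assume ind: "indep_family \<psi> X"
  then have inj: "inj_on \<psi> X" and li: "fvec.independent (\<psi> ` X)"
    by (auto simp: indep_family_def)
  show ?R
  proof (intro allI impI ballI)
    fix c x assume 0: "(\<Sum>x\<in>X. fscale (c x) (\<psi> x)) = 0" and x: "x \<in> X"
    have "(\<Sum>v\<in>\<psi> ` X. fscale (c (the_inv_into X \<psi> v)) v) = (\<Sum>x\<in>X. fscale (c x) (\<psi> x))"
      unfolding sum.reindex[OF inj] o_def
      by (intro sum.cong) (simp_all add: the_inv_into_f_f[OF inj])
    then have "c (the_inv_into X \<psi> (\<psi> x)) = 0"
      using fvec.independentD[OF li, of "\<psi> ` X" "\<lambda>v. c (the_inv_into X \<psi> v)" "\<psi> x"] 0 x assms
      by auto
    then show "c x = 0" using x by (simp add: the_inv_into_f_f[OF inj])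
  qed
next
  assume R: ?R
  have inj: "inj_on \<psi> X"
  proof (rule inj_onI, rule ccontr)
    fix x y assume xy: "x \<in> X" "y \<in> X" "\<psi> x = \<psi> y" "x \<noteq> y"
    \<comment> \<open>Coefficients 1 and -1 turn a repeated vector into a nontrivial
      relation.\<close>
    define c where "c = (\<lambda>z. if z = x then 1 else if z = y then - 1 else (0::'b))"
    have "(\<Sum>z\<in>X. fscale (c z) (\<psi> z)) = (\<Sum>z\<in>{x, y}. fscale (c z) (\<psi> z))"
      using assms xy by (intro sum.mono_neutral_right) (auto simp: c_def)
    also have "\<dots> = 0" using xy by (simp add: c_def)
    finally have "c x = 0" using R xy by blast
    then show False by (simp add: c_def)
  qed
  moreover have "fvec.independent (\<psi> ` X)"
  proof (rule fvec.independent_if_scalars_zero)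
    fix f v assume 0: "(\<Sum>v\<in>\<psi> ` X. fscale (f v) v) = 0" and v: "v \<in> \<psi> ` X"
    have "(\<Sum>x\<in>X. fscale (f (\<psi> x)) (\<psi> x)) = 0"
      using 0 by (simp add: sum.reindex[OF inj])
    then show "f v = 0" using R[rule_format, of "f \<circ> \<psi>"] v by auto
  qed (use assms in simp)
  ultimately show "indep_family \<psi> X" by (simp add: indep_family_def)
qed

lemma indep_family_cong:
  "(\<And>x. x \<in> X \<Longrightarrow> \<psi> x = \<chi> x) \<Longrightarrow> indep_family \<psi> X \<longleftrightarrow> indep_family \<chi> X"
  by (simp add: indep_family_def inj_on_def cong: image_cong_simp)

lemma indep_family_image:
  "inj_on f X \<Longrightarrow> indep_family \<psi> (f ` X) \<longleftrightarrow> indep_family (\<psi> \<circ> f) X"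
  by (auto simp: indep_family_def image_comp intro: comp_inj_on inj_on_imageI)

lemma indep_family_comp_imp_inj: "indep_family (\<psi> \<circ> f) X \<Longrightarrow> inj_on f X"
  by (auto simp: indep_family_def dest: inj_on_imageI2)

lemma indep_family_nonzero: "indep_family \<psi> X \<Longrightarrow> x \<in> X \<Longrightarrow> \<psi> x \<noteq> 0"
  by (metis fvec.dependent_zero image_eqI indep_family_def)

lemma indep_family_mono: "indep_family \<psi> X \<Longrightarrow> Y \<subseteq> X \<Longrightarrow> indep_family \<psi> Y"
  by (meson fvec.independent_mono image_mono indep_family_def inj_on_subset)

text \<open>Without the zero vector, the lines of nonzero vectors are exactly the points of
  \<open>PG\<close>. The degenerate value \<open>{0}\<close> at zero lets membership in a line be an
  equivalence relation on all vectors.\<close>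

definition line :: "(nat \<Rightarrow> 'f::field) \<Rightarrow> (nat \<Rightarrow> 'f) set" where
  "line v = {fscale c v | c. c \<noteq> 0}"

lemma fscale_apply: "fscale c v i = c * v i"
  by (simp add: fscale_def)

lemma line_self [simp]: "v \<in> line v"
  by (auto simp: line_def intro: exI[of _ 1])

lemma line_zero [simp]: "line 0 = {0}"
  by (auto simp: line_def intro: exI[of _ 1])

lemma fscale_in_line [simp]: "c \<noteq> 0 \<Longrightarrow> fscale c v \<in> line v"
  by (auto simp: line_def)

lemma line_eq: "v \<in> line u \<Longrightarrow> line v = line u"
proof -
  assume "v \<in> line u"
  then obtain a where a: "a \<noteq> 0" "v = fscale a u" by (auto simp: line_def)
  have "fscale c u \<in> line v" if "c \<noteq> 0" for c
    using that a by (auto simp: line_def intro!: exI[of _ "c / a"])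
  moreover have "fscale c v \<in> line u" if "c \<noteq> 0" for c
    using that a by (auto simp: line_def intro!: exI[of _ "c * a"])
  ultimately show ?thesis by (auto simp: line_def)
qed

lemma line_eq_iff: "line v = line u \<longleftrightarrow> v \<in> line u"
  using line_eq line_self by blast

lemma line_fscale [simp]: "c \<noteq> 0 \<Longrightarrow> line (fscale c v) = line v"
  by (simp add: line_eq_iff)

lemma zero_in_line_iff [simp]: "0 \<in> line v \<longleftrightarrow> v = 0"
  by (metis line_eq line_self line_zero singletonD)

text \<open>A relation among the rescaled vectors becomes one among the original ones by moving the
  nonzero factors into the coefficients.\<close>

lemma indep_family_rescale:
  assumes "finite X" and lin: "\<And>x. x \<in> X \<Longrightarrow> \<chi> x \<in> line (\<psi> x)" and ind: "indep_family \<psi> X"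
  shows "indep_family \<chi> X"
proof -
  have "\<forall>x\<in>X. \<exists>a. a \<noteq> 0 \<and> \<chi> x = fscale a (\<psi> x)" using lin by (force simp: line_def)
  then obtain a where a: "\<And>x. x \<in> X \<Longrightarrow> a x \<noteq> 0 \<and> \<chi> x = fscale (a x) (\<psi> x)" by metis
  show ?thesis unfolding indep_family_iff[OF assms(1)]
  proof (intro allI impI ballI)
    fix c x assume 0: "(\<Sum>x\<in>X. fscale (c x) (\<chi> x)) = 0" and x: "x \<in> X"
    have "(\<Sum>x\<in>X. fscale (c x * a x) (\<psi> x)) = (\<Sum>x\<in>X. fscale (c x) (\<chi> x))"
      using a by (intro sum.cong) auto
    with 0 have "(\<Sum>x\<in>X. fscale (c x * a x) (\<psi> x)) = 0" by simp
    with ind[unfolded indep_family_iff[OF assms(1)], rule_format, of "\<lambda>x. c x * a x", OF _ x]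
    show "c x = 0" using a[OF x] by simp
  qed
qed

lemma indep_family_line_cong:
  assumes "finite X" and "\<And>x. x \<in> X \<Longrightarrow> line (\<chi> x) = line (\<psi> x)"
  shows "indep_family \<chi> X \<longleftrightarrow> indep_family \<psi> X"
  using assms by (metis indep_family_rescale line_eq_iff)

lemma indep_family_same_line:
  assumes ind: "indep_family \<psi> X" and xy: "x \<in> X" "y \<in> X" "line (\<psi> x) = line (\<psi> y)"
  shows "x = y"
proof (rule ccontr)
  assume ne: "x \<noteq> y"
  have "indep_family \<psi> {x, y}" using indep_family_mono[OF ind] xy by auto
  \<comment> \<open>Rescaling both vectors to \<open>\<psi> y\<close> yields a constant family on
    two indices, which cannot be injective.\<close>
  then have "indep_family (\<lambda>z. \<psi> y) {x, y}"
    by (rule indep_family_rescale[rotated 2]) (use xy in \<open>auto simp flip: line_eq_iff\<close>)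
  then show False using ne by (auto simp: indep_family_def inj_on_def)
qed

text \<open>The kernel is only required to be trivial on \<open>S\<close>: coordinate maps are
  defined on all sequences but injective only on tuples of the right length.\<close>

lemma indep_family_linear:
  assumes "finite X" and S: "fvec.subspace S" "\<psi> ` X \<subseteq> S"
    and Ladd: "\<And>u v. L (u + v) = L u + L v" and Lscale: "\<And>c v. L (fscale c v) = fscale c (L v)"
    and inj: "\<And>v. v \<in> S \<Longrightarrow> L v = 0 \<Longrightarrow> v = 0"
  shows "indep_family (L \<circ> \<psi>) X \<longleftrightarrow> indep_family \<psi> X"
proof -
  have L0: "L 0 = 0" using Lscale[of 0 0] by simp
  have Lsum: "L (\<Sum>x\<in>X. fscale (c x) (\<psi> x)) = (\<Sum>x\<in>X. fscale (c x) (L (\<psi> x)))" for c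
    using assms(1) by (induction X) (simp_all only: sum.empty sum.insert L0 Ladd Lscale not_False_eq_True)
  have "(\<Sum>x\<in>X. fscale (c x) (\<psi> x)) \<in> S" for c
    using S by (intro fvec.subspace_sum fvec.subspace_scale) auto
  then have "(\<Sum>x\<in>X. fscale (c x) (L (\<psi> x))) = 0 \<longleftrightarrow> (\<Sum>x\<in>X. fscale (c x) (\<psi> x)) = 0" for c
    using inj L0 by (metis Lsum)
  then show ?thesis by (simp add: indep_family_iff[OF assms(1)])
qed

section \<open>Coordinate spaces, their subspaces, and dimension by counting\<close>

lemma subspace_tuples: "fvec.subspace (tuples n)"
  by (auto simp: fvec.subspace_def tuples_def fscale_apply)

lemma tuples_add [intro]: "u \<in> tuples n \<Longrightarrow> v \<in> tuples n \<Longrightarrow> u + v \<in> tuples n"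
  by (simp add: tuples_def)

lemma tuples_fscale [intro]: "v \<in> tuples n \<Longrightarrow> fscale c v \<in> tuples n"
  by (simp add: tuples_def fscale_apply)

lemma tuples_zero [simp]: "0 \<in> tuples n"
  by (simp add: tuples_def)

lemma line_subset_tuples: "v \<in> tuples n \<Longrightarrow> line v \<subseteq> tuples n"
  by (auto simp: line_def)

lemma tuples_bij_PiE:
  "bij_betw (\<lambda>v. restrict v {..<n}) (tuples n) ({..<n} \<rightarrow>\<^sub>E (UNIV :: 'f::field set))"
  by (rule bij_betw_byWitness[where f' = "\<lambda>g i. if i < n then g i else 0"])
    (auto simp: tuples_def fun_eq_iff PiE_def extensional_def)

lemma finite_tuples [simp]: "finite (tuples n :: (nat \<Rightarrow> 'f::{field,finite}) set)"
  using bij_betw_finite[OF tuples_bij_PiE[where 'f = 'f]] by (simp add: finite_PiE)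

lemma card_tuples: "card (tuples n :: (nat \<Rightarrow> 'f::{field,finite}) set) = CARD('f) ^ n"
  using bij_betw_same_card[OF tuples_bij_PiE[where 'f = 'f]] by (simp add: card_PiE)

lemma card_field_ge_2: "CARD('f::{field,finite}) \<ge> 2"
proof -
  have "card {0, 1 :: 'f} \<le> CARD('f)" by (intro card_mono) auto
  then show ?thesis by simp
qed

lemma card_line:
  assumes "v \<noteq> (0 :: nat \<Rightarrow> 'f::{field,finite})"
  shows "card (line v) = CARD('f) - 1"
proof -
  have "line v = (\<lambda>c. fscale c v) ` (UNIV - {0})" by (auto simp: line_def)
  moreover have "inj_on (\<lambda>c. fscale c v) (UNIV - {0})"
    using assms by (auto simp: inj_on_def)
  ultimately show ?thesis by (simp add: card_image)
qed

lemma finite_line [simp]: "finite (line (v :: nat \<Rightarrow> 'f::{field,finite}))"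
proof -
  have "line v = (\<lambda>c. fscale c v) ` (UNIV - {0})" by (auto simp: line_def)
  then show ?thesis by simp
qed

text \<open>The linear parametrisation of the span of \<open>b 0\<close>, ...,
  \<open>b (d - 1)\<close>; its inverse on \<open>tuples d\<close> reads off coordinates.\<close>

definition combine :: "(nat \<Rightarrow> nat \<Rightarrow> 'f) \<Rightarrow> nat \<Rightarrow> (nat \<Rightarrow> 'f) \<Rightarrow> nat \<Rightarrow> 'f::field" where
  "combine b d c = (\<Sum>i<d. fscale (c i) (b i))"

lemma combine_add: "combine b d (u + v) = combine b d u + combine b d v"
  by (simp add: combine_def fvec.scale_left_distrib sum.distrib)

lemma combine_fscale: "combine b d (fscale c v) = fscale c (combine b d v)"
  by (simp add: combine_def fvec.scale_sum_right fscale_apply)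

lemma combine_zero_iff:
  assumes "indep_family b {..<d}" and "c \<in> tuples d"
  shows "combine b d c = 0 \<longleftrightarrow> c = 0"
proof
  assume "combine b d c = 0"
  then have "\<forall>i<d. c i = 0" using assms(1)[unfolded indep_family_iff[OF finite_lessThan]]
    by (auto simp: combine_def)
  then show "c = 0" using assms(2) by (auto simp: tuples_def fun_eq_iff) (metis not_less)
qed (simp add: combine_def)

lemma combine_bij:
  assumes ind: "indep_family b {..<d}"
  shows "bij_betw (combine b d) (tuples d) (fvec.span (b ` {..<d}))"
  unfolding bij_betw_def
proof
  show "inj_on (combine b d) (tuples d)"
  proof (rule inj_onI)
    fix u v assume uv: "u \<in> tuples d" "v \<in> tuples d" "combine b d u = combine b d v"
    have "combine b d (u + fscale (- 1) v) = 0"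
      unfolding combine_add combine_fscale uv(3) by simp
    moreover have "u + fscale (- 1) v \<in> tuples d"
      using uv by (intro tuples_add tuples_fscale)
    ultimately show "u = v" using combine_zero_iff[OF ind] by fastforce
  qed
  have inj: "inj_on b {..<d}" using ind by (simp add: indep_family_def)
  have "combine b d c \<in> fvec.span (b ` {..<d})" for c
    unfolding combine_def by (intro fvec.span_sum fvec.span_scale fvec.span_base) auto
  moreover have "v \<in> combine b d ` tuples d" if v: "v \<in> fvec.span (b ` {..<d})" for v
  proof -
    obtain u where "v = (\<Sum>w\<in>b ` {..<d}. fscale (u w) w)"
      using v by (auto simp: fvec.span_finite)
    then have "v = combine b d (\<lambda>i. if i < d then u (b i) else 0)"
      by (simp add: combine_def sum.reindex[OF inj])
    moreover have "(\<lambda>i. if i < d then u (b i) else 0) \<in> tuples d" by (simp add: tuples_def)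
    ultimately show ?thesis by blast
  qed
  ultimately show "combine b d ` tuples d = fvec.span (b ` {..<d})" by blast
qed

lemma finite_indep_enum:
  assumes "fvec.independent B" "finite B"
  obtains b where "indep_family b {..<card B}" "b ` {..<card B} = B"
proof -
  obtain b where "bij_betw b {0..<card B} B" using ex_bij_betw_nat_finite assms(2) by blast
  then have "bij_betw b {..<card B} B" by (simp add: lessThan_atLeast0)
  then show ?thesis using that assms(1) by (auto simp: bij_betw_def indep_family_def)
qed

lemma card_span:
  fixes B :: "(nat \<Rightarrow> 'f::{field,finite}) set"
  assumes "fvec.independent B" "finite B"
  shows "card (fvec.span B) = CARD('f) ^ card B"
proof -
  obtain b where "indep_family b {..<card B}" "b ` {..<card B} = B"
    using finite_indep_enum[OF assms] .
  then show ?thesis using bij_betw_same_card[OF combine_bij] by (metis card_tuples)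
qed

text \<open>Counting takes the place of dimension theory: the span has q^(card B) vectors and lies
  in a space of q^n.\<close>

lemma independent_tuples:
  fixes B :: "(nat \<Rightarrow> 'f::{field,finite}) set"
  assumes "fvec.independent B" "B \<subseteq> tuples n"
  shows "card B \<le> n" and "card B = n \<Longrightarrow> fvec.span B = tuples n"
proof -
  have fin: "finite B" using assms(2) finite_subset finite_tuples by blast
  have sub: "fvec.span B \<subseteq> tuples n"
    using assms(2) by (intro fvec.span_minimal subspace_tuples)
  have le: "card (fvec.span B) \<le> card (tuples n :: (nat \<Rightarrow> 'f) set)"
    using sub by (intro card_mono) auto
  then show "card B \<le> n"
    using card_field_ge_2[where 'f = 'f]
    by (simp add: card_span[OF assms(1) fin] card_tuples power_increasing_iff)
  assume "card B = n"
  then show "fvec.span B = tuples n"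
    using sub by (intro card_subset_eq) (auto simp: card_span[OF assms(1) fin] card_tuples)
qed

text \<open>The size q^d is recorded along with the coordinates because dimensions are read off from
  cardinalities throughout.\<close>

lemma subspace_coordinates:
  fixes S :: "(nat \<Rightarrow> 'f::{field,finite}) set"
  assumes "fvec.subspace S" "S \<subseteq> tuples n"
  obtains b d where "indep_family b {..<d}" "b ` {..<d} \<subseteq> S" "fvec.span (b ` {..<d}) = S"
    "bij_betw (combine b d) (tuples d) S" "card S = CARD('f) ^ d" "d \<le> n"
proof -
  obtain B where B: "B \<subseteq> S" "fvec.independent B" "S \<subseteq> fvec.span B"
    using fvec.maximal_independent_subset by blast
  have fin: "finite B" using B(1) assms(2) by (meson finite_subset finite_tuples subset_trans)
  obtain b where b: "indep_family b {..<card B}" "b ` {..<card B} = B"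
    using finite_indep_enum[OF B(2) fin] .
  have sp: "fvec.span B = S"
    using fvec.span_minimal[OF B(1) assms(1)] B(3) by (rule equalityI)
  show ?thesis
    using that[OF b(1), unfolded b(2), OF B(1) sp] combine_bij[OF b(1), unfolded b(2) sp]
      card_span[OF B(2) fin, unfolded sp] independent_tuples(1)[OF B(2) subset_trans[OF B(1) assms(2)]]
    by blast
qed

section \<open>Weights on projective space\<close>

text \<open>The functionals on \<open>tuples r\<close> are the maps \<open>dot r u\<close> with
  \<open>u\<close> in \<open>tuples r\<close>; the nonzero \<open>u\<close> stand for the linear
  hyperplanes, q - 1 of them for each.\<close>

definition dot :: "nat \<Rightarrow> (nat \<Rightarrow> 'f::field) \<Rightarrow> (nat \<Rightarrow> 'f) \<Rightarrow> 'f" where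
  "dot r u v = (\<Sum>i<r. u i * v i)"

lemma dot_commute: "dot r u v = dot r v u"
  by (simp add: dot_def mult.commute)

lemma dot_add_right: "dot r u (v + w) = dot r u v + dot r u w"
  by (simp add: dot_def distrib_left sum.distrib)

lemma dot_add_left: "dot r (u + v) w = dot r u w + dot r v w"
  by (simp add: dot_def distrib_right sum.distrib)

lemma dot_fscale_right: "dot r u (fscale c v) = c * dot r u v"
  by (simp add: dot_def fscale_apply sum_distrib_left mult.left_commute)

lemma dot_fscale_left: "dot r (fscale c u) v = c * dot r u v"
  by (simp add: dot_def fscale_apply sum_distrib_left mult.assoc)

lemma dot_zero_right [simp]: "dot r u 0 = 0"
  by (simp add: dot_def)

lemma dot_zero_left [simp]: "dot r 0 u = 0"
  by (simp add: dot_def)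

lemma dot_line: "v \<in> line w \<Longrightarrow> dot r u v = 0 \<longleftrightarrow> dot r u w = 0"
  by (auto simp: line_def dot_fscale_right)

lemma subspace_orth: "fvec.subspace {v. dot r u v = 0}"
  by (auto simp: fvec.subspace_def dot_add_right dot_fscale_right)

lemma dot_span: "v \<in> fvec.span A \<Longrightarrow> (\<And>a. a \<in> A \<Longrightarrow> dot r u a = 0) \<Longrightarrow> dot r u v = 0"
  using fvec.span_minimal[OF _ subspace_orth, of A r u] by auto

lemma tuples_nonzeroE:
  assumes "v \<in> tuples r" "v \<noteq> 0"
  obtains i where "i < r" "v i \<noteq> 0"
  using assms unfolding tuples_def fun_eq_iff
  by (metis (mono_tags, lifting) leI mem_Collect_eq zero_fun_apply)

text \<open>A combination of two unit vectors. The entries are added, so i = j is allowed;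
  \<open>two_point 0 1 0 0\<close> is the first unit vector.\<close>

definition two_point :: "nat \<Rightarrow> 'f \<Rightarrow> nat \<Rightarrow> 'f \<Rightarrow> nat \<Rightarrow> 'f::field" where
  "two_point i a j b = (\<lambda>l. (if l = i then a else 0) + (if l = j then b else 0))"

lemma two_point_tuples: "i < r \<Longrightarrow> j < r \<Longrightarrow> two_point i a j b \<in> tuples r"
  by (auto simp: two_point_def tuples_def)

lemma dot_two_point: "i < r \<Longrightarrow> j < r \<Longrightarrow> dot r (two_point i a j b) v = a * v i + b * v j"
  by (simp add: dot_def two_point_def distrib_right sum.distrib if_distrib[of "\<lambda>x. x * _"]
      cong: if_cong)

lemma ex_dot_eq_1:
  assumes "v \<in> tuples r" "v \<noteq> 0"
  obtains t where "t \<in> tuples r" "dot r t v = 1"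
proof -
  obtain i where i: "i < r" "v i \<noteq> 0" using tuples_nonzeroE[OF assms] .
  show ?thesis
    by (rule that[of "two_point i (1 / v i) i 0"]) (use i in \<open>auto simp: dot_two_point two_point_tuples\<close>)
qed

lemma ex_dot_separating:
  assumes x: "x \<in> tuples r" "x \<noteq> 0" and v: "v \<in> tuples r" "v \<noteq> 0" "v \<notin> line x"
  obtains t where "t \<in> tuples r" "dot r t x = 0" "dot r t v = 1"
proof -
  obtain i where i: "i < r" "x i \<noteq> 0" using tuples_nonzeroE[OF x] .
  \<comment> \<open>\<open>v\<close> is reduced modulo \<open>x\<close> so that coordinate
    \<open>i\<close> vanishes; the rest is nonzero because \<open>v\<close> is no multiple of
    \<open>x\<close>.\<close>
  define y where "y = v + fscale (- (v i / x i)) x"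
  have "y \<noteq> 0"
  proof
    assume y0: "y = 0"
    have "v = fscale (v i / x i) x"
    proof
      fix l show "v l = fscale (v i / x i) x l"
        using fun_cong[OF y0, of l] by (simp add: y_def fscale_apply)
    qed
    then show False using v x by (metis fscale_in_line fvec.scale_zero_left)
  qed
  moreover have "y \<in> tuples r" unfolding y_def using v x by (intro tuples_add tuples_fscale)
  ultimately obtain j where j: "j < r" "y j \<noteq> 0" using tuples_nonzeroE by blast
  have yi: "y i = 0" using i by (simp add: y_def fscale_apply)
  \<comment> \<open>The entry at \<open>j\<close> gives value 1 on \<open>y\<close>, where the entry
    at \<open>i\<close> is not seen; the entry at \<open>i\<close> is chosen to cancel the
    contribution of \<open>x j\<close>.\<close>
  define t where "t = two_point i (- (x j / x i) / y j) j (1 / y j)"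
  have tx: "dot r t x = 0" using i j by (simp add: t_def dot_two_point)
  have "dot r t y = 1" using i j yi by (simp add: t_def dot_two_point)
  then have "dot r t v = 1"
    using tx unfolding y_def dot_add_right dot_fscale_right by simp
  moreover have "t \<in> tuples r" using i j by (simp add: t_def two_point_tuples)
  ultimately show ?thesis using that tx by blast
qed

text \<open>Pigeonhole: evaluating a functional on a basis of \<open>S\<close> gives one of q^d =
  card S value tuples, fewer than there are functionals. The difference of two functionals with
  equal values vanishes on \<open>S\<close>.\<close>

lemma ex_orthogonal:
  fixes S :: "(nat \<Rightarrow> 'f::{field,finite}) set"
  assumes S: "fvec.subspace S" "S \<subset> tuples r"
  obtains u where "u \<in> tuples r" "u \<noteq> 0" "\<And>v. v \<in> S \<Longrightarrow> dot r u v = 0"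
proof -
  obtain b d where b: "fvec.span (b ` {..<d}) = S" "card S = CARD('f) ^ d"
    using subspace_coordinates[OF S(1) psubset_imp_subset[OF S(2)]] by metis
  define F where "F = (\<lambda>u i. if i < d then dot r u (b i) else 0)"
  have "card S < card (tuples r :: (nat \<Rightarrow> 'f) set)" using S(2) by (intro psubset_card_mono) auto
  moreover have "F ` tuples r \<subseteq> tuples d" by (auto simp: F_def tuples_def)
  then have "card (F ` tuples r) \<le> card (tuples d :: (nat \<Rightarrow> 'f) set)"
    by (intro card_mono) auto
  ultimately have "card (F ` tuples r) < card (tuples r :: (nat \<Rightarrow> 'f) set)"
    using b(2) by (simp add: card_tuples)
  then have "\<not> inj_on F (tuples r)" using card_image[of F "tuples r"] by auto
  then obtain u1 u2 where u: "u1 \<in> tuples r" "u2 \<in> tuples r" "u1 \<noteq> u2" "F u1 = F u2"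
    by (auto simp: inj_on_def)
  define u where "u = u1 + fscale (- 1) u2"
  have "dot r u (b i) = 0" if "i < d" for i
    using fun_cong[OF u(4), of i] that
    unfolding u_def dot_add_left dot_fscale_left by (simp add: F_def)
  then have "dot r u v = 0" if "v \<in> S" for v
    using that b(1) dot_span[of v "b ` {..<d}"] by blast
  moreover have "u \<in> tuples r" unfolding u_def using u by (intro tuples_add tuples_fscale)
  moreover have "u \<noteq> 0" using u(3) by (simp add: u_def)
  ultimately show ?thesis using that by blast
qed

lemma dot_all_zero:
  assumes "u \<in> tuples r" "\<And>v. v \<in> tuples r \<Longrightarrow> dot r u v = 0"
  shows "u = 0"
  using assms ex_dot_eq_1[of u r] by (metis dot_commute zero_neq_one)

text \<open>The fibres of \<open>h\<close> are translates of each other, so they all have the same weight.\<close>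

lemma sum_fibres:
  fixes K :: "(nat \<Rightarrow> 'f::{field,finite}) set" and w :: "_ \<Rightarrow> int"
  assumes fin: "finite K" and clos: "\<And>k c. k \<in> K \<Longrightarrow> k + fscale c t \<in> K"
    and h: "\<And>k c. k \<in> K \<Longrightarrow> h (k + fscale c t) = h k + c"
    and w: "\<And>k c. k \<in> K \<Longrightarrow> w (k + fscale c t) = w k"
  shows "sum w K = int CARD('f) * sum w {k \<in> K. h k = (0::'f)}"
proof -
  have cancel: "k + fscale c t + fscale (- c) t = k" for k c
    by (simp add: fun_eq_iff fscale_apply)
  have fib: "sum w {k \<in> K. h k = c} = sum w {k \<in> K. h k = 0}" for c
  proof (rule sum.reindex_bij_witness[where ?i = "\<lambda>k. k + fscale c t" and ?j = "\<lambda>k. k + fscale (- c) t"])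
    fix k assume k: "k \<in> {k \<in> K. h k = c}"
    show "k + fscale (- c) t + fscale c t = k" using cancel[of k "- c"] by simp
    show "k + fscale (- c) t \<in> {k \<in> K. h k = 0}" using k clos[of k "-c"] h[of k "-c"] by auto
    show "w (k + fscale (- c) t) = w k" using k w[of k "-c"] by blast
  next
    fix k assume k: "k \<in> {k \<in> K. h k = 0}"
    show "k + fscale c t + fscale (- c) t = k" by (rule cancel)
    show "k + fscale c t \<in> {k \<in> K. h k = c}" using k clos[of k c] h[of k c] by auto
  qed
  have "sum w K = (\<Sum>c\<in>UNIV. sum w {k \<in> K. h k = c})"
    using fin by (intro sum.group[symmetric]) auto
  also have "\<dots> = (\<Sum>c\<in>(UNIV :: 'f set). sum w {k \<in> K. h k = 0})"
    by (intro sum.cong refl fib)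
  finally show ?thesis by simp
qed

lemma card_fibres:
  fixes K :: "(nat \<Rightarrow> 'f::{field,finite}) set"
  assumes "finite K" "\<And>k c. k \<in> K \<Longrightarrow> k + fscale c t \<in> K"
    and "\<And>k c. k \<in> K \<Longrightarrow> h (k + fscale c t) = h k + c"
  shows "int (card K) = int CARD('f) * int (card {k \<in> K. h k = (0::'f)})"
  using sum_fibres[OF assms(1,2), where h = h and w = "\<lambda>_. 1"] assms(3) by simp

section \<open>Counting the functionals orthogonal to one or two vectors\<close>

lemma card_orth:
  assumes "v \<in> tuples r" "v \<noteq> (0 :: nat \<Rightarrow> 'f::{field,finite})"
  shows "int (card (tuples r :: (nat \<Rightarrow> 'f) set)) = int CARD('f) * int (card {u \<in> tuples r. dot r u v = 0})"
proof -
  obtain t where "t \<in> tuples r" "dot r t v = 1" using ex_dot_eq_1[OF assms] .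
  then show ?thesis
    by (intro card_fibres[where t = t] finite_tuples tuples_add tuples_fscale)
      (simp_all add: dot_add_left dot_fscale_left)
qed

text \<open>Adding multiples of a functional \<open>t\<close> that kills \<open>x\<close> and takes
  value 1 on \<open>v\<close> moves freely between the values at \<open>v\<close> without disturbing
  orthogonality to \<open>x\<close>.\<close>

lemma card_orth2:
  assumes x: "x \<in> tuples r" "x \<noteq> 0"
    and v: "v \<in> tuples r" "v \<noteq> (0 :: nat \<Rightarrow> 'f::{field,finite})" "v \<notin> line x"
  shows "int (card {u \<in> tuples r. dot r u x = 0}) =
    int CARD('f) * int (card {u \<in> tuples r. dot r u x = 0 \<and> dot r u v = 0})"
proof -
  obtain t where t: "t \<in> tuples r" "dot r t x = 0" "dot r t v = 1"
    using ex_dot_separating[OF assms] .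
  have "int (card {u \<in> tuples r. dot r u x = 0}) =
    int CARD('f) * int (card {u \<in> {u \<in> tuples r. dot r u x = 0}. dot r u v = 0})"
    using t by (intro card_fibres[where t = t])
      (auto simp: dot_add_left dot_fscale_left intro!: tuples_add tuples_fscale)
  then show ?thesis by (simp add: conj_assoc)
qed

text \<open>Weighted double counting of incidences, used for hyperplanes against vectors and for
  vectors against matroid elements.\<close>

lemma sum_swap_Collect:
  fixes w :: "'b \<Rightarrow> int"
  assumes "finite A" "finite B"
  shows "(\<Sum>u\<in>A. sum w {v \<in> B. P u v}) = (\<Sum>v\<in>B. w v * int (card {u \<in> A. P u v}))"
proof -
  have "(\<Sum>u\<in>A. sum w {v \<in> B. P u v}) = (\<Sum>u\<in>A. \<Sum>v\<in>B. if P u v then w v else 0)"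
    using assms by (simp add: sum.inter_filter)
  also have "\<dots> = (\<Sum>v\<in>B. \<Sum>u\<in>A. if P u v then w v else 0)" by (rule sum.swap)
  also have "\<dots> = (\<Sum>v\<in>B. \<Sum>u | u \<in> A \<and> P u v. w v)"
    unfolding sum.inter_filter[OF assms(1)] ..
  finally show ?thesis by (simp add: mult.commute)
qed

text \<open>A weight function on projective points, spread over their homogeneous coordinate
  vectors.\<close>

locale projective_weight =
  fixes r :: nat and w :: "(nat \<Rightarrow> 'f::{field,finite}) \<Rightarrow> int"
  assumes w_zero: "w 0 = 0" and w_fscale: "c \<noteq> 0 \<Longrightarrow> w (fscale c v) = w v"
begin

abbreviation "V \<equiv> tuples r :: (nat \<Rightarrow> 'f) set"

definition "total_weight = sum w V"

text \<open>For nonzero \<open>u\<close> this is (q - 1) times the total minus q times the weight of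
  the complement of the hyperplane: it is nonnegative iff the complement has at most the average
  weight. At u = 0 the value is (q - 1) times the total.\<close>

definition "defect u = int CARD('f) * sum w {v \<in> V. dot r u v = 0} - total_weight"

lemma sum_w_line_or_zero:
  assumes "x \<in> V" "x \<noteq> 0"
  shows "sum w {v \<in> V. v = 0 \<or> v \<in> line x} = (int CARD('f) - 1) * w x"
proof -
  have "{v \<in> V. v = 0 \<or> v \<in> line x} = insert 0 (line x)"
    using line_subset_tuples[OF assms(1)] by auto
  moreover have "sum w (line x) = (\<Sum>v\<in>line x. w x)"
    by (intro sum.cong) (auto simp: line_def w_fscale)
  ultimately show ?thesis
    using assms card_field_ge_2[where 'f = 'f] by (simp add: w_zero card_line of_nat_diff)
qed

text \<open>Every nonzero vector is killed by one q-th of all functionals, the zero functional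
  included, so q times the hyperplane weights add up to card V copies of the total.\<close>

lemma sum_defect: "sum defect V = 0"
proof -
  have "int CARD('f) * (\<Sum>u\<in>V. sum w {v \<in> V. dot r u v = 0}) =
      (\<Sum>v\<in>V. w v * (int CARD('f) * int (card {u \<in> V. dot r u v = 0})))"
    unfolding sum_swap_Collect[OF finite_tuples finite_tuples]
    by (simp add: sum_distrib_left mult.left_commute)
  also have "\<dots> = (\<Sum>v\<in>V. w v * int (card V))"
  proof (intro sum.cong refl)
    fix v assume v: "v \<in> V"
    show "w v * (int CARD('f) * int (card {u \<in> V. dot r u v = 0})) = w v * int (card V)"
      using card_orth[OF v] by (cases "v = 0") (simp_all add: w_zero)
  qed
  finally show ?thesis
    by (simp add: defect_def sum_subtractf total_weight_def flip: sum_distrib_left sum_distrib_right)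
qed

text \<open>Inversion of the finite Radon transform.\<close>

lemma sum_defect_orth:
  assumes x: "x \<in> V" "x \<noteq> 0"
  shows "sum defect {u \<in> V. dot r u x = 0} =
    (int CARD('f) - 1)\<^sup>2 * int (card {u \<in> V. dot r u x = 0}) * w x"
proof -
  let ?q = "int CARD('f)" and ?O = "{u \<in> V. dot r u x = 0}"
  have "?q * (\<Sum>u\<in>?O. sum w {v \<in> V. dot r u v = 0}) =
      (\<Sum>v\<in>V. w v * (?q * int (card {u \<in> ?O. dot r u v = 0})))"
    by (subst sum_swap_Collect) (simp_all add: sum_distrib_left mult.left_commute)
  \<comment> \<open>Every \<open>v\<close> contributes the generic amount; on the line of
    \<open>x\<close> and at zero, orthogonality to \<open>v\<close> is implied by orthogonality to
    \<open>x\<close>, so the count is q times as large, an excess of q - 1.\<close>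
  also have "\<dots> = (\<Sum>v\<in>V. w v * int (card ?O) +
      (if v = 0 \<or> v \<in> line x then w v * ((?q - 1) * int (card ?O)) else 0))"
  proof (intro sum.cong refl)
    fix v assume v: "v \<in> V"
    show "w v * (?q * int (card {u \<in> ?O. dot r u v = 0})) = w v * int (card ?O) +
      (if v = 0 \<or> v \<in> line x then w v * ((?q - 1) * int (card ?O)) else 0)"
    proof (cases "v = 0 \<or> v \<in> line x")
      case True
      then have "{u \<in> ?O. dot r u v = 0} = ?O" by (auto simp: dot_line)
      with True show ?thesis by (simp add: algebra_simps)
    next
      case False
      then have "?q * int (card {u \<in> ?O. dot r u v = 0}) = int (card ?O)"
        using card_orth2[OF x v] by (simp add: conj_assoc)
      with False show ?thesis by simp
    qed
  qed
  also have "\<dots> = total_weight * int (card ?O) +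
      sum w {v \<in> V. v = 0 \<or> v \<in> line x} * ((?q - 1) * int (card ?O))"
    by (simp add: sum.distrib total_weight_def sum_distrib_right flip: sum.inter_filter)
  finally show ?thesis
    unfolding sum_w_line_or_zero[OF x]
    by (simp add: defect_def sum_subtractf algebra_simps power2_eq_square flip: sum_distrib_left)
qed

text \<open>The averaging over hyperplanes that avoid \<open>x\<close>: both the sum over all
  functionals and, by inversion, the sum over those killing \<open>x\<close> vanish. The zero
  functional falls into the latter.\<close>

lemma sum_defect_not_orth:
  assumes x: "x \<in> V" "x \<noteq> 0" "w x = 0"
  shows "sum defect {u \<in> V. dot r u x \<noteq> 0} = 0"
proof -
  have "sum defect V = sum defect {u \<in> V. dot r u x = 0} + sum defect {u \<in> V. dot r u x \<noteq> 0}"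
    by (subst sum.union_disjoint[symmetric]) (auto intro: sum.cong)
  then show ?thesis using sum_defect sum_defect_orth[OF x(1,2)] x(3) by simp
qed

lemma ex_not_orth: "x \<in> V \<Longrightarrow> x \<noteq> 0 \<Longrightarrow> \<exists>u\<in>V. u \<noteq> 0 \<and> dot r u x \<noteq> 0"
  using ex_dot_eq_1[of x r] by (metis dot_zero_left zero_neq_one)

lemma ex_defect_nonneg:
  assumes x: "x \<in> V" "x \<noteq> 0" "w x = 0"
  shows "\<exists>u\<in>V. u \<noteq> 0 \<and> defect u \<ge> 0"
proof (rule ccontr)
  assume "\<not> ?thesis"
  then have neg: "defect u < 0" if "u \<in> V" "u \<noteq> 0" for u using that by force
  have "{u \<in> V. dot r u x \<noteq> 0} \<noteq> {}" using ex_not_orth[OF x(1,2)] by blast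
  moreover have "defect u < 0" if "u \<in> {u \<in> V. dot r u x \<noteq> 0}" for u
    using neg[of u] that by (cases "u = 0") auto
  ultimately have "sum defect {u \<in> V. dot r u x \<noteq> 0} < 0"
    using sum_strict_mono[of "{u \<in> V. dot r u x \<noteq> 0}" defect "\<lambda>_. 0"] by simp
  then show False using sum_defect_not_orth[OF x] by simp
qed

text \<open>By inversion, the weight of a nonzero \<open>x\<close> depends only on which functionals
  in \<open>Q\<close> kill \<open>x\<close>, and all of \<open>Q\<close> kills \<open>z\<close>, so
  \<open>v\<close> and \<open>v + z\<close> look alike. The set \<open>Z\<close> is not assumed to
  be a subspace; that will be a consequence.\<close>

lemma weight_invariant:
  assumes nonpos: "\<And>u. u \<in> V \<Longrightarrow> u \<noteq> 0 \<Longrightarrow> defect u \<le> 0"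
    and v: "v \<in> V" and z: "z \<in> V" "w z = 0"
  shows "w (v + z) = w v"
proof -
  define Z where "Z = {z \<in> V. w z = 0}"
  \<comment> \<open>The functionals not killing \<open>y\<close> have defects of one sign with sum
    zero, so each of these defects vanishes.\<close>
  have zero: "defect u = 0" if u: "u \<in> V" and y: "y \<in> Z" "dot r u y \<noteq> 0" for u y
  proof -
    have y': "y \<in> V" "y \<noteq> 0" "w y = 0" using y by (auto simp: Z_def)
    have "(\<Sum>u\<in>{u \<in> V. dot r u y \<noteq> 0}. - defect u) = 0"
      using sum_defect_not_orth[OF y'] by (simp add: sum_negf)
    moreover have "- defect u' \<ge> 0" if "u' \<in> {u \<in> V. dot r u y \<noteq> 0}" for u'
      using nonpos[of u'] that by (cases "u' = 0") auto
    ultimately have "\<forall>u\<in>{u \<in> V. dot r u y \<noteq> 0}. - defect u = 0"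
      using sum_nonneg_eq_0_iff[of "{u \<in> V. dot r u y \<noteq> 0}" "\<lambda>u. - defect u"] by simp
    then show ?thesis using u y by auto
  qed
  define Q where "Q = {u \<in> V. \<forall>y\<in>Z. dot r u y = 0}"
  have restr: "sum defect {u \<in> V. dot r u x = 0} = sum defect {u \<in> Q. dot r u x = 0}" for x
    by (rule sum.mono_neutral_right) (use zero in \<open>auto simp: Q_def\<close>)
  have card: "int (card {u \<in> V. dot r u x = 0}) = int (card {u \<in> V. dot r u y = 0})"
    if "x \<in> V" "x \<noteq> 0" "y \<in> V" "y \<noteq> 0" for x y
    using card_orth[OF that(1,2)] card_orth[OF that(3,4)] by simp
  have same: "w x = w y"
    \<comment> \<open>The factor in front of the weight in the inversion formula is positive and the
      same for all nonzero vectors, so equal sums give equal weights.\<close>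
    if xy: "x \<in> V" "x \<noteq> 0" "y \<in> V" "y \<noteq> 0" and perp: "{u \<in> Q. dot r u x = 0} = {u \<in> Q. dot r u y = 0}"
    for x y
  proof -
    have "(int CARD('f) - 1)\<^sup>2 * int (card {u \<in> V. dot r u x = 0}) * w x =
      (int CARD('f) - 1)\<^sup>2 * int (card {u \<in> V. dot r u x = 0}) * w y"
      using sum_defect_orth[OF xy(1,2)] sum_defect_orth[OF xy(3,4)] restr[of x] restr[of y]
        perp card[OF xy] by simp
    moreover have "card {u \<in> V. dot r u x = 0} \<noteq> 0"
      by (auto simp: card_eq_0_iff intro: exI[of _ 0])
    ultimately show ?thesis using card_field_ge_2[where 'f = 'f]
      by (simp del: card_eq_0_iff card_0_eq)
  qed
  have zZ: "z \<in> Z" using z by (simp add: Z_def)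
  \<comment> \<open>The inversion formula needs nonzero vectors; in the two degenerate cases both
    weights are zero since \<open>z\<close> has weight zero.\<close>
  consider "v = 0" | "v + z = 0" | "v \<noteq> 0" "v + z \<noteq> 0" by blast
  then show ?thesis
  proof cases
    case 1 then show ?thesis using z by (simp add: w_zero)
  next
    case 2
    then have "v = fscale (- 1) z" by (simp add: eq_neg_iff_add_eq_0)
    then have "w v = w z" using w_fscale[of "- 1" z] by simp
    then show ?thesis using 2 z by (simp add: w_zero)
  next
    case 3
    show ?thesis
      by (rule same) (use 3 v z zZ in \<open>auto simp: Q_def dot_add_right\<close>)
  qed
qed

text \<open>A missing vector off the hyperplane translates the hyperplane onto all its parallel
  affine hyperplanes without changing weight, so it carries exactly one q-th of the total.\<close>

lemma defect_zero_if_invariant: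
  assumes inv: "\<And>v z. v \<in> V \<Longrightarrow> z \<in> V \<Longrightarrow> w z = 0 \<Longrightarrow> w (v + z) = w v"
    and z: "z \<in> V" "w z = 0" "dot r u z \<noteq> 0"
  shows "defect u = 0"
proof -
  \<comment> \<open>Scaled so that adding \<open>fscale c t\<close> raises the functional by exactly
    \<open>c\<close>.\<close>
  define t where "t = fscale (1 / dot r u z) z"
  have t: "t \<in> V" "w t = 0" "dot r u t = 1"
    using z by (auto simp: t_def w_fscale dot_fscale_right)
  have wt: "w (fscale c t) = 0" for c
    using t(2) by (cases "c = 0") (simp_all add: w_zero w_fscale)
  have "sum w V = int CARD('f) * sum w {v \<in> V. dot r u v = 0}"
  proof (rule sum_fibres[where t = t])
    fix k c assume "k \<in> V"
    with t show "w (k + fscale c t) = w k" "k + fscale c t \<in> V"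
      by (auto intro!: inv wt tuples_add tuples_fscale)
    show "dot r u (k + fscale c t) = dot r u k + c"
      using t by (simp add: dot_add_right dot_fscale_right)
  qed simp
  then show ?thesis by (simp add: defect_def total_weight_def)
qed

end

section \<open>Represented matroids and their simplifications\<close>

lemma indep_family_empty [simp]: "indep_family \<psi> {}"
  by (simp add: indep_family_def fvec.independent_empty)

lemma indep_family_single: "indep_family \<psi> {e} \<longleftrightarrow> \<psi> e \<noteq> 0"
  by (simp add: indep_family_def)

lemma indep_family_pair:
  assumes "e \<noteq> f" "\<psi> e \<noteq> 0" "\<psi> f \<noteq> 0"
  shows "indep_family \<psi> {e, f} \<longleftrightarrow> line (\<psi> e) \<noteq> line (\<psi> f)"
proof
  assume "indep_family \<psi> {e, f}"
  then show "line (\<psi> e) \<noteq> line (\<psi> f)" using indep_family_same_line[of \<psi> "{e, f}" e f] assms by auto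
next
  assume ne: "line (\<psi> e) \<noteq> line (\<psi> f)"
  have "c e = 0 \<and> c f = 0" if "(\<Sum>x\<in>{e, f}. fscale (c x) (\<psi> x)) = 0" for c
  proof -
    have sum: "fscale (c e) (\<psi> e) + fscale (c f) (\<psi> f) = 0" using that assms(1) by simp
    have "c e = 0"
    proof (rule ccontr)
      assume ce: "c e \<noteq> 0"
      have "\<psi> e i = - (c f / c e) * \<psi> f i" for i
        using fun_cong[OF sum, of i] ce by (simp add: fscale_apply field_simps eq_neg_iff_add_eq_0)
      then have eq: "\<psi> e = fscale (- (c f / c e)) (\<psi> f)" by (simp add: fun_eq_iff fscale_apply)
      then have "- (c f / c e) \<noteq> 0" using assms(2) by fastforce
      then show False using eq ne by (metis line_fscale)
    qed
    then show ?thesis using sum assms(3) by simp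
  qed
  then show "indep_family \<psi> {e, f}" by (simp add: indep_family_iff)
qed

text \<open>Finiteness and containment in the ground set are built in, so simplifications and
  restrictions can be handled through their vectors without first being shown to be
  matroids.\<close>

definition represents :: "('a \<Rightarrow> nat \<Rightarrow> 'f::field) \<Rightarrow> 'a mstruct \<Rightarrow> bool" where
  "represents \<psi> M \<longleftrightarrow> finite (ground M) \<and> (\<forall>X. indep M X \<longleftrightarrow> X \<subseteq> ground M \<and> indep_family \<psi> X)"

lemma represents_indep: "represents \<psi> M \<Longrightarrow> indep M X \<longleftrightarrow> X \<subseteq> ground M \<and> indep_family \<psi> X"
  by (simp add: represents_def)

lemma represents_finite: "represents \<psi> M \<Longrightarrow> finite (ground M)"
  by (simp add: represents_def)

lemma represents_mloop: "represents \<psi> M \<Longrightarrow> mloop M e \<longleftrightarrow> e \<in> ground M \<and> \<psi> e = 0"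
  by (auto simp: mloop_def mcircuit_def represents_indep indep_family_single psubset_eq
      subset_singleton_iff)

lemma represents_parallel:
  assumes "represents \<psi> M"
  shows "parallel M e f \<longleftrightarrow> e \<in> ground M \<and> f \<in> ground M \<and> \<psi> e \<noteq> 0 \<and> line (\<psi> f) = line (\<psi> e)"
proof (cases "e \<in> ground M \<and> f \<in> ground M \<and> \<psi> e \<noteq> 0 \<and> \<psi> f \<noteq> 0 \<and> e \<noteq> f")
  case True
  have "indep M X" if "X \<subset> {e, f}" for X
  proof -
    have "X = {} \<or> X = {e} \<or> X = {f}" using that by auto
    then show ?thesis using True by (auto simp: represents_indep[OF assms] indep_family_single)
  qed
  then have "mcircuit M {e, f} \<longleftrightarrow> line (\<psi> e) = line (\<psi> f)"
    using True by (auto simp: mcircuit_def represents_indep[OF assms] indep_family_pair)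
  then show ?thesis using True by (auto simp: parallel_def represents_mloop[OF assms])
next
  case False
  have "line (\<psi> f) = line (\<psi> e) \<Longrightarrow> \<psi> f = 0 \<longleftrightarrow> \<psi> e = 0"
    by (metis zero_in_line_iff)
  then show ?thesis using False by (auto simp: parallel_def represents_mloop[OF assms])
qed

lemma represents_class:
  assumes "represents \<psi> M" "C \<in> parallel_classes M" "e \<in> C"
  shows "e \<in> ground M" "\<psi> e \<noteq> 0" "C = {f \<in> ground M. line (\<psi> f) = line (\<psi> e)}"
    "{f. parallel M e f} = C"
proof -
  obtain a where a: "a \<in> ground M" "\<psi> a \<noteq> 0" "C = {f. parallel M a f}"
    using assms(2) by (auto simp: parallel_classes_def represents_mloop[OF assms(1)])
  have e: "e \<in> ground M" "line (\<psi> e) = line (\<psi> a)"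
    using assms(3) by (auto simp: a represents_parallel[OF assms(1)])
  show "e \<in> ground M" by fact
  show nz: "\<psi> e \<noteq> 0" using a e by (metis zero_in_line_iff)
  show "C = {f \<in> ground M. line (\<psi> f) = line (\<psi> e)}"
    using a e by (auto simp: represents_parallel[OF assms(1)])
  show "{f. parallel M e f} = C"
    using a e nz by (auto simp: represents_parallel[OF assms(1)])
qed

lemma class_of:
  assumes "represents \<psi> M" "e \<in> ground M" "\<psi> e \<noteq> 0"
  shows "{f. parallel M e f} \<in> parallel_classes M" "e \<in> {f. parallel M e f}"
  using assms by (auto simp: parallel_classes_def represents_mloop represents_parallel)

lemma class_nonempty:
  assumes "represents \<psi> M" "C \<in> parallel_classes M"
  shows "(SOME e. e \<in> C) \<in> C"
proof -
  obtain a where "a \<in> ground M" "\<not> mloop M a" "C = {f. parallel M a f}"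
    using assms(2) by (auto simp: parallel_classes_def)
  then have "a \<in> C" using class_of[OF assms(1)] by (auto simp: represents_mloop[OF assms(1)])
  then show ?thesis by (rule someI)
qed

lemma class_unique:
  assumes "represents \<psi> M" "C \<in> parallel_classes M" "D \<in> parallel_classes M"
    "e \<in> C" "f \<in> D" "line (\<psi> e) = line (\<psi> f)"
  shows "C = D"
  using represents_class(3)[OF assms(1,2,4)] represents_class(3)[OF assms(1,3,5)] assms(6) by simp

lemma si_ground [simp]: "ground (si M) = parallel_classes M"
  by (simp add: si_def)

lemma finite_parallel_classes: "represents \<psi> M \<Longrightarrow> finite (parallel_classes M)"
  by (rule finite_subset[of _ "Pow (ground M)"])
    (auto simp: represents_finite parallel_classes_def parallel_def)

text \<open>Any vector on the common line may stand for a class, and any system of representatives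
  gives the same answer, because independence ignores nonzero scalars.\<close>

lemma represents_si:
  assumes M: "represents \<psi> M"
    and \<chi>: "\<And>C e. C \<in> parallel_classes M \<Longrightarrow> e \<in> C \<Longrightarrow> line (\<chi> C) = line (\<psi> e)"
  shows "represents \<chi> (si M)"
  unfolding represents_def
proof (intro conjI allI)
  show "finite (ground (si M))" using finite_parallel_classes[OF M] by simp
  fix \<C>
  have reps: "indep M (rep ` \<C>) \<longleftrightarrow> indep_family \<chi> \<C>"
    if sub: "\<C> \<subseteq> parallel_classes M" and rep: "\<forall>C\<in>\<C>. rep C \<in> C" for rep
  proof -
    have fin: "finite \<C>" using finite_parallel_classes[OF M] sub by (rule rev_finite_subset)
    have inj: "inj_on rep \<C>"
    proof (rule inj_onI)
      fix C D assume CD: "C \<in> \<C>" "D \<in> \<C>" "rep C = rep D"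
      show "C = D"
        by (rule class_unique[OF M, of C D "rep C" "rep D"]) (use CD sub rep in auto)
    qed
    have "rep ` \<C> \<subseteq> ground M" using represents_class(1)[OF M] sub rep by blast
    then have "indep M (rep ` \<C>) \<longleftrightarrow> indep_family (\<psi> \<circ> rep) \<C>"
      by (simp add: represents_indep[OF M] indep_family_image[OF inj])
    also have "\<dots> \<longleftrightarrow> indep_family \<chi> \<C>"
    proof (rule indep_family_line_cong[OF fin])
      fix C assume "C \<in> \<C>"
      then show "line ((\<psi> \<circ> rep) C) = line (\<chi> C)" using \<chi>[of C "rep C"] sub rep by auto
    qed
    finally show ?thesis .
  qed
  have "\<exists>rep. \<forall>C\<in>\<C>. rep C \<in> C" if "\<C> \<subseteq> parallel_classes M"
    by (rule exI[of _ "\<lambda>C. SOME e. e \<in> C"]) (use class_nonempty[OF M] that in blast)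
  then show "indep (si M) \<C> \<longleftrightarrow> \<C> \<subseteq> ground (si M) \<and> indep_family \<chi> \<C>"
    using reps by (auto simp: si_def)
qed

text \<open>This carries an arbitrary embedding of the simplification back to \<open>M\<close>:
  nonloops inherit the vector of their class, while \<open>\<psi>\<close> only tells which elements
  are loops and which are parallel.\<close>

lemma represents_of_si:
  assumes M: "represents \<psi> M" and si: "represents \<chi> (si M)"
  shows "represents (\<lambda>e. if \<psi> e = 0 then 0 else \<chi> {f. parallel M e f}) M" (is "represents ?\<xi> M")
  unfolding represents_def
proof (intro conjI allI)
  show "finite (ground M)" by (rule represents_finite[OF M])
  fix X
  let ?c = "\<lambda>e. {f. parallel M e f}"
  have "indep_family \<psi> X \<longleftrightarrow> indep_family ?\<xi> X" if sub: "X \<subseteq> ground M"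
  \<comment> \<open>For nonloops in distinct classes both sides say that the set of classes is
    independent in \<open>si M\<close>. Otherwise a zero vector or two elements of one class make
    both sides false.\<close>
  proof (cases "(\<forall>e\<in>X. \<psi> e \<noteq> 0) \<and> inj_on ?c X")
    case True
    have cl: "?c ` X \<subseteq> parallel_classes M" using class_of[OF M] sub True by blast
    have fin: "finite X" using sub represents_finite[OF M] finite_subset by blast
    have r1: "represents (\<lambda>C. \<psi> (SOME e. e \<in> C)) (si M)"
      using class_nonempty[OF M] represents_class(3)[OF M]
      by (intro represents_si[OF M]) blast
    have "indep_family \<psi> X \<longleftrightarrow> indep_family ((\<lambda>C. \<psi> (SOME e. e \<in> C)) \<circ> ?c) X"
    proof (rule indep_family_line_cong[OF fin])
      fix e assume e: "e \<in> X"
      have "?c e \<in> parallel_classes M" "e \<in> ?c e" using class_of[OF M, of e] e sub True by auto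
      then have "(SOME f. f \<in> ?c e) \<in> ?c e" using class_nonempty[OF M] by blast
      then have "parallel M e (SOME f. f \<in> ?c e)" by blast
      then have "line (\<psi> (SOME f. f \<in> ?c e)) = line (\<psi> e)"
        unfolding represents_parallel[OF M] by blast
      then show "line (\<psi> e) = line (((\<lambda>C. \<psi> (SOME e. e \<in> C)) \<circ> ?c) e)"
        unfolding o_def by (rule sym)
    qed
    also have "\<dots> \<longleftrightarrow> indep (si M) (?c ` X)"
      using cl True by (simp add: represents_indep[OF r1] indep_family_image)
    also have "\<dots> \<longleftrightarrow> indep_family (\<chi> \<circ> ?c) X"
      using cl True by (simp add: represents_indep[OF si] indep_family_image)
    also have "\<dots> \<longleftrightarrow> indep_family ?\<xi> X"
      using True by (intro indep_family_cong) auto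
    finally show ?thesis .
  next
    case False
    have "\<not> indep_family \<psi> X"
    proof
      assume ind: "indep_family \<psi> X"
      have "inj_on ?c X"
      proof (rule inj_onI)
        fix e f assume ef: "e \<in> X" "f \<in> X" "?c e = ?c f"
        then have "e \<in> ?c f" using class_of(2)[OF M, of e] sub indep_family_nonzero[OF ind] by blast
        then show "e = f" using indep_family_same_line[OF ind ef(1,2)]
          by (simp add: represents_parallel[OF M])
      qed
      then show False using False indep_family_nonzero[OF ind] by blast
    qed
    moreover have "\<not> indep_family ?\<xi> X"
    proof
      assume ind: "indep_family ?\<xi> X"
      have nz: "\<forall>e\<in>X. \<psi> e \<noteq> 0" using indep_family_nonzero[OF ind] by meson
      have "indep_family (\<chi> \<circ> ?c) X \<longleftrightarrow> indep_family ?\<xi> X"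
        using nz by (intro indep_family_cong) auto
      then have "inj_on ?c X" using ind indep_family_comp_imp_inj by blast
      then show False using nz False by blast
    qed
    ultimately show ?thesis by blast
  qed
  then show "indep M X \<longleftrightarrow> X \<subseteq> ground M \<and> indep_family ?\<xi> X"
    by (auto simp: represents_indep[OF M])
qed

lemma represents_mrestrict: "represents \<psi> M \<Longrightarrow> represents \<psi> (mrestrict M X)"
  by (auto simp: represents_def mrestrict_def)

lemma represents_iso:
  assumes f: "iso_map f M N" and N: "represents \<chi> N" and sub: "\<And>X. indep M X \<Longrightarrow> X \<subseteq> ground M"
  shows "represents (\<chi> \<circ> f) M"
  unfolding represents_def
proof (intro conjI allI)
  have bij: "bij_betw f (ground M) (ground N)" using f by (simp add: iso_map_def)
  then show "finite (ground M)" using represents_finite[OF N] bij_betw_finite by blast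
  fix X
  have "indep M X \<longleftrightarrow> indep_family (\<chi> \<circ> f) X" if X: "X \<subseteq> ground M"
  proof -
    have "f ` X \<subseteq> ground N" using bij X by (auto simp: bij_betw_def)
    moreover have "inj_on f X" using bij X by (auto simp: bij_betw_def intro: inj_on_subset)
    ultimately show ?thesis
      using f X by (simp add: iso_map_def represents_indep[OF N] indep_family_image)
  qed
  then show "indep M X \<longleftrightarrow> X \<subseteq> ground M \<and> indep_family (\<chi> \<circ> f) X" using sub by blast
qed

lemma represents_embedding:
  assumes "membedding \<phi> M N" "represents \<chi> N" "\<And>X. indep M X \<Longrightarrow> X \<subseteq> ground M"
  shows "represents (\<chi> \<circ> \<phi>) M"
  using represents_iso[OF _ represents_mrestrict[OF assms(2)] assms(3)] assms(1)
  by (auto simp: membedding_def)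

text \<open>Since no class is cut by \<open>X\<close>, the classes of the restriction are literally
  classes of \<open>M\<close>, which gives an equality of structures and not just an
  isomorphism.\<close>

lemma si_mrestrict:
  assumes M: "represents \<psi> M" and X: "\<And>C. C \<in> parallel_classes M \<Longrightarrow> C \<subseteq> X \<or> C \<inter> X = {}"
  shows "si (mrestrict M X) = mrestrict (si M) {C. C \<subseteq> X}"
proof -
  let ?N = "mrestrict M X"
  have N: "represents \<psi> ?N" by (rule represents_mrestrict[OF M])
  have gr: "ground ?N = ground M \<inter> X" by (simp add: mrestrict_def)
  have par: "{f. parallel ?N e f} = {f. parallel M e f}"
    if "e \<in> ground M" "e \<in> X" "\<psi> e \<noteq> 0" for e
  proof -
    have "{f. parallel M e f} \<subseteq> X" using X class_of[OF M that(1,3)] that(2) by blast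
    then show ?thesis
      using that by (auto simp: represents_parallel[OF M] represents_parallel[OF N] gr)
  qed
  have pc: "parallel_classes ?N = parallel_classes M \<inter> {C. C \<subseteq> X}" (is "?L = ?R")
  proof
    show "?L \<subseteq> ?R"
    proof
      fix C assume "C \<in> ?L"
      then obtain e where e: "e \<in> ground M" "e \<in> X" "\<psi> e \<noteq> 0" "C = {f. parallel ?N e f}"
        by (auto simp: parallel_classes_def represents_mloop[OF N] gr)
      then show "C \<in> ?R" using X par[OF e(1,2,3)] class_of[OF M e(1,3)] by fastforce
    qed
    show "?R \<subseteq> ?L"
    proof
      fix C assume C: "C \<in> ?R"
      define e where "e = (SOME e. e \<in> C)"
      have e: "e \<in> C" using class_nonempty[OF M] C unfolding e_def by blast
      then have "e \<in> ground M" "e \<in> X" "\<psi> e \<noteq> 0" "C = {f. parallel M e f}"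
        using represents_class[OF M _ e] C by auto
      then show "C \<in> ?L" using class_of(1)[OF N, of e] par[of e] by (simp add: gr)
    qed
  qed
  have "(\<lambda>\<C>. \<C> \<subseteq> parallel_classes ?N \<and> (\<exists>rep. (\<forall>C\<in>\<C>. rep C \<in> C) \<and> indep ?N (rep ` \<C>))) =
    (\<lambda>\<C>. (\<C> \<subseteq> parallel_classes M \<and> (\<exists>rep. (\<forall>C\<in>\<C>. rep C \<in> C) \<and> indep M (rep ` \<C>))) \<and> \<C> \<subseteq> {C. C \<subseteq> X})"
    unfolding pc by (rule ext) (auto simp: mrestrict_def subset_iff)
  then show ?thesis by (simp add: si_def mrestrict_def pc[unfolded mrestrict_def])
qed

lemma represents_subset: "represents \<psi> M \<Longrightarrow> indep M X \<Longrightarrow> X \<subseteq> ground M"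
  by (simp add: represents_indep)

lemma mrestrict_cong:
  assumes "represents \<psi> M" "ground M \<inter> A = ground M \<inter> B"
  shows "mrestrict M A = mrestrict M B"
  using assms represents_subset[OF assms(1)] by (auto simp: mrestrict_def fun_eq_iff)

section \<open>Projective geometries and embeddings into them\<close>

lemma represents_vmatroid: "represents (\<lambda>v :: nat \<Rightarrow> 'f::{field,finite}. v) (vmatroid n)"
  by (auto simp: represents_def vmatroid_def indep_family_def)

lemma PG_ground: "ground (PG n :: (nat \<Rightarrow> 'f::{field,finite}) set mstruct) = {line v | v. v \<in> tuples n \<and> v \<noteq> 0}"
proof -
  have ground: "ground (vmatroid n :: (nat \<Rightarrow> 'f) mstruct) = tuples n"
    by (simp add: vmatroid_def)
  have par: "{f :: nat \<Rightarrow> 'f. parallel (vmatroid n) e f} = line e" if "e \<in> tuples n" "e \<noteq> 0" for e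
    using that line_subset_tuples[of e n]
    by (auto simp: represents_parallel[OF represents_vmatroid] ground line_eq_iff)
  have "parallel_classes (vmatroid n) =
      {{f :: nat \<Rightarrow> 'f. parallel (vmatroid n) e f} | e. e \<in> tuples n \<and> e \<noteq> 0}"
    unfolding parallel_classes_def represents_mloop[OF represents_vmatroid] ground by meson
  also have "\<dots> = {line v | v. v \<in> tuples n \<and> v \<noteq> 0}"
    by (intro Collect_cong) (metis par)
  finally show ?thesis by (simp add: PG_def)
qed

text \<open>Homogeneous coordinates of a point, determined only up to a nonzero factor; facts about
  them therefore pass through \<open>line\<close>.\<close>

definition point_vector :: "'b set \<Rightarrow> 'b" where
  "point_vector p = (SOME v. v \<in> p)"

lemma line_point_vector: "line (point_vector (line v)) = line v"
  by (metis line_eq line_self point_vector_def someI)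

lemma represents_PG: "represents point_vector (PG n :: (nat \<Rightarrow> 'f::{field,finite}) set mstruct)"
  unfolding PG_def
proof (rule represents_si[OF represents_vmatroid])
  fix C :: "(nat \<Rightarrow> 'f) set" and e
  assume C: "C \<in> parallel_classes (vmatroid n)" and e: "e \<in> C"
  then obtain v where "C = line v" using PG_ground[of n] by (auto simp: PG_def)
  then show "line (point_vector C) = line e" using e by (simp add: line_point_vector line_eq)
qed

lemma ex_embedding:
  fixes \<psi> :: "'a \<Rightarrow> nat \<Rightarrow> 'f::{field,finite}"
  assumes M: "represents \<psi> M" and im: "\<psi> ` ground M \<subseteq> tuples d"
  obtains \<phi> where "membedding \<phi> (si M) (PG d)"
    "\<phi> ` ground (si M) = {line (\<psi> e) | e. e \<in> ground M \<and> \<psi> e \<noteq> 0}"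
proof -
  define \<phi> where "\<phi> = (\<lambda>C. line (\<psi> (SOME e. e \<in> C)))"
  have phi: "\<phi> C = line (\<psi> e)" if "C \<in> parallel_classes M" "e \<in> C" for C e
    using represents_class(3)[OF M that] class_nonempty[OF M that(1)] unfolding \<phi>_def by blast
  have img: "\<phi> ` ground (si M) = {line (\<psi> e) | e. e \<in> ground M \<and> \<psi> e \<noteq> 0}" (is "?L = ?R")
  proof
    show "?L \<subseteq> ?R"
      using class_nonempty[OF M] represents_class(1,2)[OF M] by (auto simp: \<phi>_def)
    show "?R \<subseteq> ?L"
    proof
      fix p assume "p \<in> ?R"
      then obtain e where e: "e \<in> ground M" "\<psi> e \<noteq> 0" "p = line (\<psi> e)" by blast
      then show "p \<in> ?L" using phi class_of[OF M e(1,2)] by (metis imageI si_ground)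
    qed
  qed
  have sub: "\<phi> ` ground (si M) \<subseteq> ground (PG d)"
    unfolding img PG_ground using im by blast
  have inj: "inj_on \<phi> (ground (si M))"
  proof (rule inj_onI)
    fix C D assume "C \<in> ground (si M)" "D \<in> ground (si M)" "\<phi> C = \<phi> D"
    then show "C = D" using class_unique[OF M, of C D] class_nonempty[OF M] by (auto simp: \<phi>_def)
  qed
  have r: "represents (point_vector \<circ> \<phi>) (si M)"
    by (rule represents_si[OF M]) (simp add: phi line_point_vector)
  have "iso_map \<phi> (si M) (mrestrict (PG d) (\<phi> ` ground (si M)))"
    unfolding iso_map_def
  proof (intro conjI allI impI)
    show "bij_betw \<phi> (ground (si M)) (ground (mrestrict (PG d) (\<phi> ` ground (si M))))"
      using inj sub by (auto simp: bij_betw_def mrestrict_def)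
    fix X assume X: "X \<subseteq> ground (si M)"
    have "\<phi> ` X \<subseteq> ground (PG d)" "\<phi> ` X \<subseteq> \<phi> ` ground (si M)" using X sub by auto
    moreover have "inj_on \<phi> X" using X inj by (rule inj_on_subset[rotated])
    ultimately show "indep (si M) X \<longleftrightarrow> indep (mrestrict (PG d) (\<phi> ` ground (si M))) (\<phi> ` X)"
      using X by (simp add: represents_indep[OF r] mrestrict_def represents_indep[OF represents_PG]
          indep_family_image)
  qed
  then show ?thesis using that sub img by (auto simp: membedding_def)
qed

section \<open>Cogirth\<close>

lemma mrank_attained:
  assumes "matroid M"
  shows "\<exists>X. indep M X \<and> card X = mrank M" and "indep M X \<Longrightarrow> card X \<le> mrank M"
proof -
  interpret matroid M by fact
  have "{X. indep M X} \<subseteq> Pow (ground M)" using indep_subset_ground by blast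
  then have fin: "finite (card ` {X. indep M X})" using finite_ground finite_subset by blast
  have "card ` {X. indep M X} \<noteq> {}" using indep_empty by blast
  then have "mrank M \<in> card ` {X. indep M X}" unfolding mrank_def by (rule Max_in[OF fin])
  then show "\<exists>X. indep M X \<and> card X = mrank M" by auto
  show "card X \<le> mrank M" if "indep M X"
    unfolding mrank_def using that by (intro Max_ge[OF fin]) simp
qed

lemma mbasis_iff:
  assumes "matroid M"
  shows "mbasis M B \<longleftrightarrow> indep M B \<and> card B = mrank M"
proof
  interpret matroid M by fact
  assume B: "mbasis M B"
  obtain X where X: "indep M X" "card X = mrank M" using mrank_attained(1)[OF assms] by blast
  have "\<not> card B < card X"
  proof
    assume "card B < card X"
    then obtain y where "y \<in> X - B" "indep M (insert y B)"
      using augment B X(1) unfolding mbasis_def by blast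
    then show False using B unfolding mbasis_def by blast
  qed
  then show "indep M B \<and> card B = mrank M"
    using B X mrank_attained(2)[OF assms, of B] by (auto simp: mbasis_def)
next
  interpret matroid M by fact
  assume B: "indep M B \<and> card B = mrank M"
  have "X = B" if "indep M X" "B \<subseteq> X" for X
    using card_seteq[of X B] that B mrank_attained(2)[OF assms that(1)]
      finite_subset[OF indep_subset_ground[OF that(1)] finite_ground] by auto
  then show "mbasis M B" using B by (simp add: mbasis_def)
qed

lemma unit_vector:
  assumes "r \<ge> 1"
  shows "(two_point 0 1 0 0 :: nat \<Rightarrow> 'f::field) \<in> tuples r" "two_point 0 1 0 0 \<noteq> (0 :: nat \<Rightarrow> 'f)"
proof -
  show "(two_point 0 1 0 0 :: nat \<Rightarrow> 'f) \<in> tuples r" using assms by (simp add: two_point_tuples)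
  show "two_point 0 1 0 0 \<noteq> (0 :: nat \<Rightarrow> 'f)"
  proof
    assume "two_point 0 1 0 0 = (0 :: nat \<Rightarrow> 'f)"
    then have "two_point 0 1 0 0 0 = (0 :: 'f)" by (simp only: zero_fun_apply)
    then show False by (simp add: two_point_def)
  qed
qed

lemma represents_linear:
  assumes M: "represents \<psi> M" and S: "fvec.subspace S" "\<chi> ` ground M \<subseteq> S"
    and L: "\<And>e. e \<in> ground M \<Longrightarrow> \<psi> e = L (\<chi> e)" "\<And>u v. L (u + v) = L u + L v"
      "\<And>c v. L (fscale c v) = fscale c (L v)" "\<And>v. v \<in> S \<Longrightarrow> L v = 0 \<Longrightarrow> v = 0"
  shows "represents \<chi> M"
  unfolding represents_def
proof (intro conjI allI)
  show fin: "finite (ground M)" by (rule represents_finite[OF M])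
  fix X
  have "indep_family \<psi> X \<longleftrightarrow> indep_family \<chi> X" if X: "X \<subseteq> ground M"
  proof -
    have "indep_family \<psi> X \<longleftrightarrow> indep_family (L \<circ> \<chi>) X"
      using X L(1) by (intro indep_family_cong) auto
    also have "\<dots> \<longleftrightarrow> indep_family \<chi> X"
      using X S L(2-4) finite_subset[OF X fin] by (intro indep_family_linear[OF _ S(1)]) auto
    finally show ?thesis .
  qed
  then show "indep M X \<longleftrightarrow> X \<subseteq> ground M \<and> indep_family \<chi> X"
    by (auto simp: represents_indep[OF M])
qed

text \<open>Coordinates with respect to the basis \<open>b\<close> shorten the vectors to length
  \<open>d\<close> without changing the matroid.\<close>

lemma represents_coordinates:
  assumes M: "represents \<psi> M" and b: "indep_family b {..<d}" "bij_betw (combine b d) (tuples d) S"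
    and im: "\<psi> ` ground M \<subseteq> S"
  defines "c \<equiv> the_inv_into (tuples d) (combine b d)"
  shows "represents (\<lambda>e. c (\<psi> e)) M" "(\<lambda>e. c (\<psi> e)) ` ground M \<subseteq> tuples d"
proof -
  have c: "c v \<in> tuples d" "combine b d (c v) = v" if "v \<in> S" for v
    using that b(2) unfolding c_def bij_betw_def
    by (auto simp: the_inv_into_into f_the_inv_into_f)
  show sub: "(\<lambda>e. c (\<psi> e)) ` ground M \<subseteq> tuples d" using c im by auto
  show "represents (\<lambda>e. c (\<psi> e)) M"
    by (rule represents_linear[OF M subspace_tuples sub, of "combine b d"])
      (use c im combine_zero_iff[OF b(1)] in \<open>auto simp: combine_add combine_fscale image_subset_iff\<close>)
qed

section \<open>Cocircuits and complements of hyperplanes\<close>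

context
  fixes M :: "'a mstruct" and \<psi> :: "'a \<Rightarrow> nat \<Rightarrow> 'f::{field,finite}" and r :: nat
  assumes matroid: "matroid M" and rank: "mrank M = r"
    and rep: "represents \<psi> M" and im: "\<psi> ` ground M \<subseteq> tuples r"
begin

lemma span_mbasis:
  assumes "mbasis M B"
  shows "fvec.span (\<psi> ` B) = tuples r"
proof -
  have B: "B \<subseteq> ground M" "inj_on \<psi> B" "fvec.independent (\<psi> ` B)" "card B = r"
    using assms by (auto simp: mbasis_iff[OF matroid] rank represents_indep[OF rep] indep_family_def)
  then have "\<psi> ` B \<subseteq> tuples r" using im by blast
  then show ?thesis using independent_tuples(2)[OF B(3)] B by (simp add: card_image)
qed

lemma meets_mbasis:
  assumes "u \<in> tuples r" "u \<noteq> 0" "mbasis M B"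
  shows "{e \<in> ground M. dot r u (\<psi> e) \<noteq> 0} \<inter> B \<noteq> {}"
proof
  assume *: "{e \<in> ground M. dot r u (\<psi> e) \<noteq> 0} \<inter> B = {}"
  have "B \<subseteq> ground M" using assms(3) by (simp add: mbasis_iff[OF matroid] represents_indep[OF rep])
  with * have "dot r u a = 0" if "a \<in> \<psi> ` B" for a using that by blast
  then have "dot r u v = 0" if "v \<in> tuples r" for v
    using that dot_span[of v "\<psi> ` B"] span_mbasis[OF assms(3)] by blast
  then show False using dot_all_zero[OF assms(1)] assms(2) by blast
qed

lemma mcocircuit_iff:
  "mcocircuit M C \<longleftrightarrow> C \<subseteq> ground M \<and> (\<forall>B. mbasis M B \<longrightarrow> C \<inter> B \<noteq> {}) \<and>
     (\<forall>X. X \<subset> C \<longrightarrow> (\<exists>B. mbasis M B \<and> X \<inter> B = {}))"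
  by (auto simp: mcocircuit_def mcircuit_def mdual_def)

lemma ex_mcocircuit_subset:
  assumes "X \<subseteq> ground M" "\<And>B. mbasis M B \<Longrightarrow> X \<inter> B \<noteq> {}"
  shows "\<exists>C\<subseteq>X. mcocircuit M C"
proof -
  have fin: "finite X" using assms(1) represents_finite[OF rep] by (rule finite_subset)
  define \<F> where "\<F> = {Y. Y \<subseteq> X \<and> (\<forall>B. mbasis M B \<longrightarrow> Y \<inter> B \<noteq> {})}"
  have "finite \<F>" using fin by (simp add: \<F>_def)
  moreover have "X \<in> \<F>" using assms(2) by (simp add: \<F>_def)
  ultimately obtain C where C: "C \<in> \<F>" "\<And>Y. Y \<in> \<F> \<Longrightarrow> Y \<subseteq> C \<Longrightarrow> Y = C"
    using finite_has_minimal2[of \<F> X] by metis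
  have "\<exists>B. mbasis M B \<and> Y \<inter> B = {}" if Y: "Y \<subset> C" for Y
  proof (rule ccontr)
    assume "\<not> ?thesis"
    then have "Y \<in> \<F>" using Y C(1) by (auto simp: \<F>_def)
    then show False using C(2)[of Y] Y by blast
  qed
  then have "mcocircuit M C" using C(1) assms(1) unfolding mcocircuit_iff \<F>_def by blast
  then show ?thesis using C(1) by (auto simp: \<F>_def)
qed

text \<open>The elements outside a cocircuit do not span, since otherwise they would contain a
  basis; hence some nonzero functional kills all of them.\<close>

lemma mcocircuit_contains:
  assumes "mcocircuit M C"
  obtains u where "u \<in> tuples r" "u \<noteq> 0" "{e \<in> ground M. dot r u (\<psi> e) \<noteq> 0} \<subseteq> C"
proof -
  let ?S = "fvec.span (\<psi> ` (ground M - C))"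
  have sub: "?S \<subseteq> tuples r" using im by (intro fvec.span_minimal subspace_tuples) auto
  have "?S \<noteq> tuples r"
  proof
    assume S: "?S = tuples r"
    obtain D where D: "D \<subseteq> \<psi> ` (ground M - C)" "fvec.independent D" "\<psi> ` (ground M - C) \<subseteq> fvec.span D"
      using fvec.maximal_independent_subset by blast
    have "?S \<subseteq> fvec.span D" using D(3) by (intro fvec.span_minimal fvec.subspace_span)
    moreover have "fvec.span D \<subseteq> tuples r"
      using D(1) im by (intro fvec.span_minimal subspace_tuples) blast
    ultimately have spD: "fvec.span D = tuples r" using S by blast
    have finD: "finite D" using D(1) represents_finite[OF rep] by (meson finite_Diff finite_surj)
    have "CARD('f) ^ card D = CARD('f) ^ r"
      using card_span[OF D(2) finD] spD by (simp add: card_tuples)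
    then have cD: "card D = r" using card_field_ge_2[where 'f = 'f] by simp
    \<comment> \<open>One element outside \<open>C\<close> is chosen for each vector of
      \<open>D\<close>; together they form a basis of \<open>M\<close> that misses
      \<open>C\<close>.\<close>
    obtain B where B: "B \<subseteq> ground M - C" "inj_on \<psi> B" "\<psi> ` B = D"
      using D(1) unfolding subset_image_inj by blast
    have "mbasis M B" using B D(2) cD
      by (auto simp: mbasis_iff[OF matroid] rank represents_indep[OF rep] indep_family_def card_image)
    then show False using assms B(1) unfolding mcocircuit_iff by blast
  qed
  with sub have "?S \<subset> tuples r" by blast
  then obtain u where u: "u \<in> tuples r" "u \<noteq> 0" "\<And>v. v \<in> ?S \<Longrightarrow> dot r u v = 0"
    using ex_orthogonal[OF fvec.subspace_span] by blast
  have "dot r u (\<psi> e) = 0" if "e \<in> ground M - C" for e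
    using that by (intro u(3) fvec.span_base) blast
  then have "{e \<in> ground M. dot r u (\<psi> e) \<noteq> 0} \<subseteq> C" by blast
  then show ?thesis using that u by blast
qed

lemma finite_mcocircuits: "finite (card ` {C. mcocircuit M C})"
proof -
  have "{C. mcocircuit M C} \<subseteq> Pow (ground M)" by (auto simp: mcocircuit_iff)
  then show ?thesis using represents_finite[OF rep] by (meson finite_Pow_iff finite_imageI finite_subset)
qed

text \<open>The complement of a hyperplane need not be a cocircuit, as the elements on the
  hyperplane may fail to span it. It meets every basis, so it contains one.\<close>

lemma cogirth_le:
  assumes "u \<in> tuples r" "u \<noteq> 0"
  shows "cogirth M \<le> card {e \<in> ground M. dot r u (\<psi> e) \<noteq> 0}"
proof -
  let ?X = "{e \<in> ground M. dot r u (\<psi> e) \<noteq> 0}"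
  obtain C where C: "C \<subseteq> ?X" "mcocircuit M C"
    using ex_mcocircuit_subset[of ?X] meets_mbasis[OF assms] by blast
  have "cogirth M \<le> card C"
    unfolding cogirth_def using C(2) by (intro Min_le finite_mcocircuits) blast
  also have "\<dots> \<le> card ?X" using C(1) represents_finite[OF rep] by (intro card_mono) auto
  finally show ?thesis .
qed

lemma cogirth_attained:
  assumes "r \<ge> 1"
  obtains u where "u \<in> tuples r" "u \<noteq> 0" "card {e \<in> ground M. dot r u (\<psi> e) \<noteq> 0} \<le> cogirth M"
proof -
  have "\<exists>C. mcocircuit M C"
    using ex_mcocircuit_subset[of "{e \<in> ground M. dot r (two_point 0 1 0 0) (\<psi> e) \<noteq> 0}"]
      meets_mbasis[OF unit_vector[OF assms]] by blast
  then have "{C. mcocircuit M C} \<noteq> {}" by blast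
  then obtain C where C: "mcocircuit M C" "card C = cogirth M"
    using Min_in[OF finite_mcocircuits] unfolding cogirth_def by auto
  obtain u where u: "u \<in> tuples r" "u \<noteq> 0" "{e \<in> ground M. dot r u (\<psi> e) \<noteq> 0} \<subseteq> C"
    using mcocircuit_contains[OF C(1)] .
  have "finite C" using C(1) represents_finite[OF rep] finite_subset by (auto simp: mcocircuit_iff)
  then show ?thesis using that[OF u(1,2)] card_mono[OF _ u(3)] C(2) by simp
qed

lemma cogirth_pos:
  assumes "r \<ge> 1"
  shows "cogirth M > 0"
proof -
  obtain u where u: "u \<in> tuples r" "u \<noteq> 0" "card {e \<in> ground M. dot r u (\<psi> e) \<noteq> 0} \<le> cogirth M"
    using cogirth_attained[OF assms] .
  obtain B where "mbasis M B" using mrank_attained(1)[OF matroid] mbasis_iff[OF matroid] by blast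
  then have "{e \<in> ground M. dot r u (\<psi> e) \<noteq> 0} \<noteq> {}" using meets_mbasis[OF u(1,2)] by blast
  then have "card {e \<in> ground M. dot r u (\<psi> e) \<noteq> 0} > 0"
    using represents_finite[OF rep] by (simp add: card_gt_0_iff)
  then show ?thesis using u(3) by simp
qed

end

text \<open>A set of distinct points of PG(r-1,q) under arbitrary names. The names are points of
  \<open>PG\<close> in one use and parallel classes of \<open>M\<close> in the other.\<close>

definition simple_representation :: "('a \<Rightarrow> nat \<Rightarrow> 'f::field) \<Rightarrow> 'a mstruct \<Rightarrow> nat \<Rightarrow> bool" where
  "simple_representation \<chi> N r \<longleftrightarrow> represents \<chi> N \<and> \<chi> ` ground N \<subseteq> tuples r - {0} \<and>
     inj_on (\<lambda>x. line (\<chi> x)) (ground N)"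

definition vectors :: "('a \<Rightarrow> nat \<Rightarrow> 'f::field) \<Rightarrow> 'a mstruct \<Rightarrow> (nat \<Rightarrow> 'f) set" where
  "vectors \<chi> N = (\<Union>x\<in>ground N. line (\<chi> x))"

lemma vectors_subset:
  assumes "simple_representation \<chi> N r"
  shows "vectors \<chi> N \<subseteq> tuples r - {0}"
proof
  fix v assume "v \<in> vectors \<chi> N"
  then obtain x where x: "x \<in> ground N" "v \<in> line (\<chi> x)" by (auto simp: vectors_def)
  then have "\<chi> x \<in> tuples r" "\<chi> x \<noteq> 0" using assms by (auto simp: simple_representation_def)
  then show "v \<in> tuples r - {0}" using x(2) line_subset_tuples by auto
qed

lemma vectors_fscale_iff: "c \<noteq> 0 \<Longrightarrow> fscale c v \<in> vectors \<chi> N \<longleftrightarrow> v \<in> vectors \<chi> N"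
proof -
  assume c: "c \<noteq> 0"
  have "fscale c v \<in> line w \<longleftrightarrow> v \<in> line w" for w
    using c by (metis line_eq_iff line_fscale)
  then show ?thesis by (simp add: vectors_def)
qed

lemma card_vectors:
  fixes \<chi> :: "'a \<Rightarrow> nat \<Rightarrow> 'f::{field,finite}"
  assumes "simple_representation \<chi> N r"
  shows "card (vectors \<chi> N) = card (ground N) * (CARD('f) - 1)"
proof -
  have fin: "finite (ground N)" and nz: "\<And>x. x \<in> ground N \<Longrightarrow> \<chi> x \<noteq> 0"
    and inj: "inj_on (\<lambda>x. line (\<chi> x)) (ground N)"
    using assms by (auto simp: simple_representation_def represents_def)
  have "card (vectors \<chi> N) = (\<Sum>x\<in>ground N. card (line (\<chi> x)))"
    unfolding vectors_def
  proof (rule card_UN_disjoint[OF fin])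
    show "\<forall>x\<in>ground N. \<forall>y\<in>ground N. x \<noteq> y \<longrightarrow> line (\<chi> x) \<inter> line (\<chi> y) = {}"
    proof (intro ballI impI)
      fix x y assume xy: "x \<in> ground N" "y \<in> ground N" "x \<noteq> y"
      then have "line (\<chi> x) \<noteq> line (\<chi> y)" using inj by (auto simp: inj_on_def)
      then show "line (\<chi> x) \<inter> line (\<chi> y) = {}" using line_eq by blast
    qed
  qed simp
  also have "\<dots> = (\<Sum>x\<in>ground N. CARD('f) - 1)" by (intro sum.cong refl) (simp add: card_line nz)
  finally show ?thesis by simp
qed

lemma simple_representation_PG:
  fixes P :: "(nat \<Rightarrow> 'f::{field,finite}) set set"
  shows "simple_representation point_vector (mrestrict (PG r) P) r"
    and "vectors point_vector (mrestrict (PG r) P) = \<Union> (ground (PG r) \<inter> P)"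
proof -
  have pv: "line (point_vector p) = p \<and> point_vector p \<in> tuples r - {0}"
    if p: "p \<in> ground (PG r)" for p :: "(nat \<Rightarrow> 'f) set"
  proof -
    obtain v where v: "p = line v" "v \<in> tuples r" "v \<noteq> 0" using p unfolding PG_ground by blast
    then have l: "line (point_vector p) = p" by (simp add: line_point_vector)
    then have "point_vector p \<in> line v" using v by (metis line_self)
    then show ?thesis using l v line_subset_tuples[OF v(2)] by auto
  qed
  then show "simple_representation point_vector (mrestrict (PG r) P) r"
    using represents_mrestrict[OF represents_PG]
    by (auto simp: simple_representation_def mrestrict_def inj_on_def)
  show "vectors point_vector (mrestrict (PG r) P) = \<Union> (ground (PG r) \<inter> P)"
    using pv by (auto simp: vectors_def mrestrict_def)
qed

lemma Union_PG: "\<Union> (ground (PG r :: (nat \<Rightarrow> 'f::{field,finite}) set mstruct)) = tuples r - {0}"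
proof
  show "\<Union> (ground (PG r)) \<subseteq> (tuples r - {0} :: (nat \<Rightarrow> 'f) set)"
    using line_subset_tuples by (auto simp: PG_ground)
  show "(tuples r - {0} :: (nat \<Rightarrow> 'f) set) \<subseteq> \<Union> (ground (PG r))"
    using line_self unfolding PG_ground by blast
qed

lemma mrestrict_ground:
  assumes "\<And>X. indep M X \<Longrightarrow> X \<subseteq> ground M"
  shows "mrestrict M (ground M) = M"
  using assms by (cases M) (auto simp: mrestrict_def fun_eq_iff)

lemma card_PG:
  "card (ground (PG k :: (nat \<Rightarrow> 'f::{field,finite}) set mstruct)) * (CARD('f) - 1) = CARD('f) ^ k - 1"
proof -
  have "mrestrict (PG k :: (nat \<Rightarrow> 'f) set mstruct) UNIV = PG k"
    by (simp add: mrestrict_def)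
  then show ?thesis
    using card_vectors[OF simple_representation_PG(1)[of k "UNIV :: (nat \<Rightarrow> 'f) set set"]]
      simple_representation_PG(2)[of k "UNIV :: (nat \<Rightarrow> 'f) set set"] card_tuples[of k, where 'f = 'f]
    by (simp add: Union_PG)
qed

text \<open>The isomorphism may be nonlinear, but it bounds the rank: a basis of the span stays
  independent in \<open>tuples k\<close>, so the span has at most q^k vectors. The points with zero
  already make up q^k, hence they fill the span.\<close>

lemma subspace_of_miso_PG:
  fixes \<chi> :: "'a \<Rightarrow> nat \<Rightarrow> 'f::{field,finite}"
  assumes N: "simple_representation \<chi> N r" and iso: "miso N (PG k :: (nat \<Rightarrow> 'f) set mstruct)"
  shows "fvec.subspace (insert 0 (vectors \<chi> N))" "card (insert 0 (vectors \<chi> N)) = CARD('f) ^ k"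
proof -
  have rep: "represents \<chi> N" and im: "\<chi> ` ground N \<subseteq> tuples r - {0}"
    using N by (auto simp: simple_representation_def)
  obtain f where f: "iso_map f N (PG k :: (nat \<Rightarrow> 'f) set mstruct)" using iso by (auto simp: miso_def)
  have rep': "represents (point_vector \<circ> f) N"
    using represents_iso[OF f represents_PG] represents_subset[OF rep] by blast
  have bij: "bij_betw f (ground N) (ground (PG k))" using f by (simp add: iso_map_def)
  have im': "(point_vector \<circ> f) ` ground N \<subseteq> tuples k"
    using bij simple_representation_PG(1)[of k "UNIV :: (nat \<Rightarrow> 'f) set set"]
    by (auto simp: simple_representation_def mrestrict_def bij_betw_def)
  let ?S = "fvec.span (\<chi> ` ground N)"
  obtain D where D: "D \<subseteq> \<chi> ` ground N" "fvec.independent D" "\<chi> ` ground N \<subseteq> fvec.span D"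
    using fvec.maximal_independent_subset by blast
  have finD: "finite D" using D(1) represents_finite[OF rep] by (meson finite_surj)
  obtain B where B: "B \<subseteq> ground N" "inj_on \<chi> B" "\<chi> ` B = D"
    using D(1) unfolding subset_image_inj by blast
  have "indep N B" using B D(2) by (simp add: represents_indep[OF rep] indep_family_def)
  then have B': "inj_on (point_vector \<circ> f) B" "fvec.independent ((point_vector \<circ> f) ` B)"
    by (auto simp: represents_indep[OF rep'] indep_family_def)
  have "card ((point_vector \<circ> f) ` B) \<le> k"
    using B'(2) B(1) im' by (intro independent_tuples(1)) auto
  then have "card D \<le> k" using B B' by (metis card_image)
  then have "card (fvec.span D) \<le> CARD('f) ^ k"
    using card_field_ge_2[where 'f = 'f] by (simp add: card_span[OF D(2) finD] power_increasing)
  moreover have "fvec.span D = ?S"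
    using D by (meson fvec.span_minimal fvec.subspace_span equalityI fvec.span_mono)
  ultimately have S: "card ?S \<le> CARD('f) ^ k" by simp
  have nz: "0 \<notin> vectors \<chi> N" and finv: "finite (vectors \<chi> N)"
    using vectors_subset[OF N] by (auto intro: finite_subset[OF _ finite_tuples[of r]])
  have "card (vectors \<chi> N) = CARD('f) ^ k - 1"
    using card_vectors[OF N] bij_betw_same_card[OF bij] card_PG[of k, where 'f = 'f] by simp
  then show c: "card (insert 0 (vectors \<chi> N)) = CARD('f) ^ k"
    using nz finv card_field_ge_2[where 'f = 'f] by simp
  have "insert 0 (vectors \<chi> N) \<subseteq> ?S"
    by (auto simp: vectors_def line_def fvec.span_zero intro!: fvec.span_scale[OF fvec.span_base])
  moreover have "?S \<subseteq> tuples r" using im by (intro fvec.span_minimal subspace_tuples) blast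
  then have "finite ?S" by (rule finite_subset) simp
  ultimately have "insert 0 (vectors \<chi> N) = ?S" using S c by (intro card_seteq) auto
  then show "fvec.subspace (insert 0 (vectors \<chi> N))" using fvec.subspace_span by metis
qed

text \<open>The restricted geometry is the simplification of the vector matroid on \<open>S\<close>.
  Coordinates identify \<open>S\<close> with \<open>tuples d\<close>, so the induced embedding into
  \<open>PG d\<close> is onto.\<close>

lemma miso_PG_of_subspace:
  fixes S :: "(nat \<Rightarrow> 'f::{field,finite}) set"
  assumes S: "fvec.subspace S" "S \<subseteq> tuples r" "card S = CARD('f) ^ k"
  shows "miso (mrestrict (PG r) {p. p \<subseteq> S}) (PG k :: (nat \<Rightarrow> 'f) set mstruct)"
proof -
  obtain b d where b: "indep_family b {..<d}" "bij_betw (combine b d) (tuples d) S" "card S = CARD('f) ^ d"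
    using subspace_coordinates[OF S(1,2)] by metis
  have dk: "d = k" using b(3) S(3) card_field_ge_2[where 'f = 'f] by simp
  define N where "N = mrestrict (vmatroid r :: (nat \<Rightarrow> 'f) mstruct) S"
  have gN: "ground N = S" using S(2) by (auto simp: N_def mrestrict_def vmatroid_def)
  define c where "c = the_inv_into (tuples d) (combine b d)"
  have N0: "represents (\<lambda>v. v) N" unfolding N_def by (rule represents_mrestrict[OF represents_vmatroid])
  have N: "represents c N" and c: "c ` ground N \<subseteq> tuples d"
    using represents_coordinates[OF N0 b(1,2)] gN unfolding c_def by auto
  obtain \<phi> where \<phi>: "membedding \<phi> (si N) (PG d)"
    "\<phi> ` ground (si N) = {line (c e) | e. e \<in> ground N \<and> c e \<noteq> 0}"
    using ex_embedding[OF N c] by blast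
  have "\<phi> ` ground (si N) = ground (PG d)"
  proof -
    have "\<exists>e\<in>S. c e = v" if "v \<in> tuples d" for v
      using that b(2) unfolding c_def bij_betw_def by (metis image_eqI the_inv_into_f_f)
    then show ?thesis unfolding \<phi>(2) PG_ground gN using c gN by blast
  qed
  then have "miso (si N) (PG d :: (nat \<Rightarrow> 'f) set mstruct)"
    using \<phi>(1) mrestrict_ground[OF represents_subset[OF represents_PG]]
    unfolding membedding_def miso_def by metis
  moreover have "si N = mrestrict (PG r) {p. p \<subseteq> S}"
    unfolding N_def PG_def
  proof (rule si_mrestrict[OF represents_vmatroid])
    fix C :: "(nat \<Rightarrow> 'f) set" assume "C \<in> parallel_classes (vmatroid r)"
    then obtain v where v: "C = line v" using PG_ground[of r, where 'f = 'f] by (auto simp: PG_def)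
    have "fscale a v \<in> S" if "fscale x v \<in> S" "x \<noteq> 0" for a x
      using fvec.subspace_scale[OF S(1) that(1), of "a / x"] that(2) by simp
    then show "C \<subseteq> S \<or> C \<inter> S = {}" by (auto simp: v line_def)
  qed
  ultimately show ?thesis using dk by simp
qed

section \<open>Affine geometries\<close>

text \<open>Collinearity of three points in terms of matroid independence, the form in which an
  isomorphism preserves it.\<close>

lemma indep_family_triple:
  assumes ef: "indep_family \<psi> {e, f}" and g: "g \<noteq> e" "g \<noteq> f"
  shows "\<not> indep_family \<psi> {e, f, g} \<longleftrightarrow> (\<exists>a b. \<psi> g = fscale a (\<psi> e) + fscale b (\<psi> f))"
proof -
  have "indep_family \<psi> {e, f, g} \<longleftrightarrow> \<psi> g \<notin> fvec.span (\<psi> ` {e, f})"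
  proof
    assume "indep_family \<psi> {e, f, g}"
    then have "inj_on \<psi> {e, f, g}" "fvec.independent (insert (\<psi> g) (\<psi> ` {e, f}))"
      by (auto simp: indep_family_def insert_commute)
    moreover have "\<psi> g \<notin> \<psi> ` {e, f}" using inj_onD[OF calculation(1)] g by blast
    ultimately show "\<psi> g \<notin> fvec.span (\<psi> ` {e, f})" by (simp add: fvec.independent_insert)
  next
    assume sp: "\<psi> g \<notin> fvec.span (\<psi> ` {e, f})"
    then have "\<psi> g \<notin> \<psi> ` {e, f}" using fvec.span_base[of "\<psi> g"] by metis
    moreover have "fvec.independent (insert (\<psi> g) (\<psi> ` {e, f}))" "inj_on \<psi> {e, f}"
      using sp ef by (auto simp: fvec.independent_insert indep_family_def)
    ultimately have "inj_on \<psi> (insert g {e, f})" by auto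
    then show "indep_family \<psi> {e, f, g}"
      using \<open>fvec.independent _\<close> by (simp add: indep_family_def insert_commute)
  qed
  also have "\<psi> g \<in> fvec.span (\<psi> ` {e, f}) \<longleftrightarrow> (\<exists>a b. \<psi> g = fscale a (\<psi> e) + fscale b (\<psi> f))"
  proof
    assume "\<psi> g \<in> fvec.span (\<psi> ` {e, f})"
    then have "\<psi> g \<in> fvec.span {\<psi> e, \<psi> f}" by simp
    then obtain a b where "\<psi> g - fscale a (\<psi> e) - fscale b (\<psi> f) = 0"
      unfolding fvec.span_breakdown_eq fvec.span_empty by auto
    then have "\<psi> g = fscale a (\<psi> e) + fscale b (\<psi> f)" by (simp add: algebra_simps)
    then show "\<exists>a b. \<psi> g = fscale a (\<psi> e) + fscale b (\<psi> f)" by blast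
  next
    assume "\<exists>a b. \<psi> g = fscale a (\<psi> e) + fscale b (\<psi> f)"
    then obtain a b where ab: "\<psi> g = fscale a (\<psi> e) + fscale b (\<psi> f)" by blast
    show "\<psi> g \<in> fvec.span (\<psi> ` {e, f})"
      unfolding ab by (intro fvec.span_add fvec.span_scale fvec.span_base) auto
  qed
  finally show ?thesis by blast
qed

lemma line_coord_nonzero: "(\<forall>w\<in>line v. w i \<noteq> 0) \<longleftrightarrow> v i \<noteq> 0"
  using line_self[of v] by (auto simp: line_def fscale_apply)

lemma AG_vectors:
  "simple_representation point_vector (AG r :: (nat \<Rightarrow> 'f::{field,finite}) set mstruct) r"
  "vectors point_vector (AG r) = {v \<in> tuples r. v 0 \<noteq> (0 :: 'f)}"
proof -
  show "simple_representation point_vector (AG r :: (nat \<Rightarrow> 'f) set mstruct) r"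
    unfolding AG_def by (rule simple_representation_PG(1))
  have "\<Union> (ground (PG r) \<inter> {p. \<forall>v\<in>p. v 0 \<noteq> (0 :: 'f)}) = {v \<in> tuples r. v 0 \<noteq> (0 :: 'f)}" (is "?L = ?R")
  proof
    show "?L \<subseteq> ?R" using line_subset_tuples by (auto simp: PG_ground)
    show "?R \<subseteq> ?L"
    proof
      fix v :: "nat \<Rightarrow> 'f" assume v: "v \<in> ?R"
      then have "v \<noteq> 0" by auto
      then have "line v \<in> ground (PG r) \<inter> {p. \<forall>v\<in>p. v 0 \<noteq> (0 :: 'f)}"
        using v line_coord_nonzero[of v] by (auto simp: PG_ground)
      then show "v \<in> ?L" using line_self by blast
    qed
  qed
  then show "vectors point_vector (AG r) = {v \<in> tuples r. v 0 \<noteq> (0 :: 'f)}"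
    unfolding AG_def simple_representation_PG(2) .
qed

lemma card_AG_vectors:
  assumes "r \<ge> 1"
  shows "int CARD('f) * int (card {v \<in> tuples r. v 0 \<noteq> (0 :: 'f::{field,finite})}) =
    (int CARD('f) - 1) * int (CARD('f) ^ r)"
proof -
  have dot: "dot r u (two_point 0 1 0 0) = u 0" for u :: "nat \<Rightarrow> 'f"
    using assms by (subst dot_commute) (simp add: dot_two_point)
  have "int (CARD('f) ^ r) = int CARD('f) * int (card {u \<in> tuples r. u 0 = (0 :: 'f)})"
    using card_orth[OF unit_vector[OF assms, where 'f = 'f]] by (simp add: dot card_tuples)
  moreover have "card (tuples r :: (nat \<Rightarrow> 'f) set) =
      card {u \<in> tuples r. u 0 = (0 :: 'f)} + card {u \<in> tuples r. u 0 \<noteq> (0 :: 'f)}"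
    by (subst card_Un_disjoint[symmetric]) (auto intro: arg_cong[of _ _ card])
  then have "int (card {u \<in> tuples r. u 0 \<noteq> (0 :: 'f)}) =
      int (CARD('f) ^ r) - int (card {u \<in> tuples r. u 0 = (0 :: 'f)})"
    by (simp add: card_tuples flip: of_nat_power)
  ultimately show ?thesis by (simp only:) (simp add: algebra_simps)
qed

text \<open>An affine line has only \<open>q\<close> points, so a set of points isomorphic to an affine geometry
  contains no projective line. The points other than \<open>a\<close> on the line through \<open>a\<close> and \<open>b\<close> are
  represented by the coset \<open>b + \<langle>\<chi> a\<rangle>\<close>.\<close>

lemma miso_AG_no_full_line:
  fixes \<chi> :: "'a \<Rightarrow> nat \<Rightarrow> 'f::{field,finite}"
  assumes N: "simple_representation \<chi> N r" and iso: "miso N (AG r :: (nat \<Rightarrow> 'f) set mstruct)"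
    and a: "a \<in> ground N" and b: "b \<noteq> 0" "b \<notin> line (\<chi> a)"
  shows "\<exists>c. b + fscale c (\<chi> a) \<notin> vectors \<chi> N"
proof (rule ccontr)
  assume "\<not> ?thesis"
  then have all: "\<forall>c. \<exists>x. x \<in> ground N \<and> b + fscale c (\<chi> a) \<in> line (\<chi> x)"
    by (auto simp: vectors_def)
  then obtain x where x: "\<And>c. x c \<in> ground N" "\<And>c. b + fscale c (\<chi> a) \<in> line (\<chi> (x c))" by metis
  have rep: "represents \<chi> N" and nz: "\<And>y. y \<in> ground N \<Longrightarrow> \<chi> y \<noteq> 0"
    and inj: "inj_on (\<lambda>x. line (\<chi> x)) (ground N)"
    using N by (auto simp: simple_representation_def)
  have lx: "line (\<chi> (x c)) = line (b + fscale c (\<chi> a))" for c using line_eq[OF x(2)] by simp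
  obtain f where f: "iso_map f N (AG r :: (nat \<Rightarrow> 'f) set mstruct)" using iso by (auto simp: miso_def)
  have AGrep: "represents point_vector (AG r :: (nat \<Rightarrow> 'f) set mstruct)"
    using AG_vectors(1)[of r, where 'f = 'f] by (simp add: simple_representation_def)
  have rep1: "represents (point_vector \<circ> f) N"
    using represents_iso[OF f AGrep] represents_subset[OF rep] by blast
  have f0: "point_vector (f y) 0 \<noteq> 0" if "y \<in> ground N" for y
  proof -
    have "f y \<in> ground (AG r)" using f that by (auto simp: iso_map_def bij_betw_def)
    then have "point_vector (f y) \<in> vectors point_vector (AG r)"
      unfolding vectors_def by (rule UN_I) simp
    then show ?thesis unfolding AG_vectors(2) by blast
  qed
  \<comment> \<open>Affine coordinates: the images in \<open>AG r\<close> are normalised to have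
    coordinate 0 equal to 1.\<close>
  define \<rho> where "\<rho> = (\<lambda>y. fscale (1 / point_vector (f y) 0) (point_vector (f y)))"
  have \<rho>0: "\<rho> y 0 = 1" if "y \<in> ground N" for y using f0[OF that] by (simp add: \<rho>_def fscale_apply)
  have ind: "indep_family \<rho> Y \<longleftrightarrow> indep_family \<chi> Y" if Y: "Y \<subseteq> ground N" for Y
  proof -
    have "indep_family \<rho> Y \<longleftrightarrow> indep_family (point_vector \<circ> f) Y"
    proof (rule indep_family_line_cong)
      show "finite Y" using Y represents_finite[OF rep] finite_subset by blast
      show "line (\<rho> y) = line ((point_vector \<circ> f) y)" if "y \<in> Y" for y
        using f0[of y] that Y by (auto simp: \<rho>_def)
    qed
    then show ?thesis using represents_indep[OF rep, of Y] represents_indep[OF rep1, of Y] Y by simp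
  qed
  have x_ne_a: "x c \<noteq> a" for c
  proof
    assume "x c = a"
    then have "b + fscale c (\<chi> a) \<in> line (\<chi> a)" using x(2)[of c] by simp
    then obtain d where d: "d \<noteq> 0" "b + fscale c (\<chi> a) = fscale d (\<chi> a)" by (auto simp: line_def)
    then have "b = fscale (d - c) (\<chi> a)" by (simp add: fvec.scale_left_diff_distrib eq_diff_eq)
    then show False using b by (metis fscale_in_line fvec.scale_zero_left)
  qed
  have x_inj: "c = d" if "x c = x d" for c d
  proof (rule ccontr)
    assume cd: "c \<noteq> d"
    have "b + fscale c (\<chi> a) \<in> line (b + fscale d (\<chi> a))" using lx that by (metis line_self)
    then obtain k where k: "k \<noteq> 0" "b + fscale c (\<chi> a) = fscale k (b + fscale d (\<chi> a))"
      by (auto simp: line_def)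
    have rel: "fscale (1 - k) b = fscale (k * d - c) (\<chi> a)"
    proof
      fix i show "fscale (1 - k) b i = fscale (k * d - c) (\<chi> a) i"
        using fun_cong[OF k(2), of i] by (simp add: fscale_apply algebra_simps)
    qed
    show False
    proof (cases "k = 1")
      case True
      then have "fscale (d - c) (\<chi> a) = 0" using rel by simp
      then show False using cd nz[OF a] by simp
    next
      case False
      then have "b = fscale ((k * d - c) / (1 - k)) (\<chi> a)"
        using arg_cong[OF rel, of "fscale (1 / (1 - k))"] by simp
      then show False using b by (metis fscale_in_line fvec.scale_zero_left)
    qed
  qed
  have pair: "indep_family \<chi> {a, x 0}"
    using x_ne_a[of 0] nz a x(1) inj by (subst indep_family_pair) (auto simp: inj_on_def)
  have on_line: "\<exists>t. \<rho> y = \<rho> a + fscale t (\<rho> (x 0) - \<rho> a)" if y: "y \<in> insert a (range x)" for y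
  proof -
    consider "y = a" | "y = x 0" | c where "y = x c" "y \<noteq> a" "y \<noteq> x 0" using y by auto
    then show ?thesis
    proof cases
      case 1 then show ?thesis by (intro exI[of _ 0]) simp
    next
      case 2 then show ?thesis by (intro exI[of _ 1]) simp
    next
      case 3
      have yN: "y \<in> ground N" using 3 x by simp
      have sub: "{a, x 0} \<subseteq> ground N" "{a, x 0, y} \<subseteq> ground N" using a x yN by auto
      have "\<chi> y \<in> line (b + fscale c (\<chi> a))" using lx[of c] 3(1) by (metis line_self)
      then obtain k where k: "\<chi> y = fscale k (b + fscale c (\<chi> a))" by (auto simp: line_def)
      have "b + fscale 0 (\<chi> a) \<in> line (\<chi> (x 0))" by (rule x(2))
      then obtain l where l: "b = fscale l (\<chi> (x 0))" by (auto simp: line_def)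
      have "\<chi> y = fscale (k * c) (\<chi> a) + fscale (k * l) (\<chi> (x 0))"
        unfolding k l by (simp add: fvec.scale_right_distrib add.commute)
      then have "\<not> indep_family \<chi> {a, x 0, y}" using indep_family_triple[OF pair 3(2,3)] by blast
      then have "\<not> indep_family \<rho> {a, x 0, y}" using ind sub by blast
      moreover have "indep_family \<rho> {a, x 0}" using pair ind sub by blast
      ultimately obtain s t where st: "\<rho> y = fscale s (\<rho> a) + fscale t (\<rho> (x 0))"
        using indep_family_triple[of \<rho> a "x 0" y] 3 by blast
      \<comment> \<open>Comparing coordinate 0 shows that the combination is affine, so
        \<open>y\<close> lies on an affine line with one parameter.\<close>
      have "1 = s + t" using fun_cong[OF st, of 0] \<rho>0 a x yN by (simp add: fscale_apply)
      then have "s = 1 - t" by (simp add: eq_diff_eq)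
      then have "\<rho> y = \<rho> a + fscale t (\<rho> (x 0) - \<rho> a)"
        by (simp add: st fvec.scale_right_diff_distrib fvec.scale_left_diff_distrib)
      then show ?thesis by blast
    qed
  qed
  have "inj_on \<rho> (ground N)"
  proof (rule inj_onI, rule ccontr)
    fix y z assume yz: "y \<in> ground N" "z \<in> ground N" "\<rho> y = \<rho> z" "y \<noteq> z"
    then have "indep_family \<chi> {y, z}"
      using nz inj by (subst indep_family_pair) (auto simp: inj_on_def)
    then have "inj_on \<rho> {y, z}" using ind[of "{y, z}"] yz by (simp add: indep_family_def)
    then show False using yz by simp
  qed
  moreover have "insert a (range x) \<subseteq> ground N" using a x(1) by auto
  ultimately have "card (insert a (range x)) = card (\<rho> ` insert a (range x))"
    by (metis card_image inj_on_subset)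
  also have "\<dots> \<le> card (range (\<lambda>t. \<rho> a + fscale t (\<rho> (x 0) - \<rho> a)))"
    using on_line by (intro card_mono) auto
  also have "\<dots> \<le> CARD('f)" by (rule card_image_le) simp
  finally have "card (insert a (range x)) \<le> CARD('f)" .
  \<comment> \<open>Together with \<open>a\<close> there are q + 1 distinct points, one more than an
    affine line holds.\<close>
  moreover have "card (range x) = CARD('f)" using x_inj by (intro card_image injI)
  moreover have "a \<notin> range x" using x_ne_a by (metis rangeE)
  ultimately show False by simp
qed

text \<open>Every coset of \<open>\<langle>\<chi> a\<rangle>\<close> contains a vector outside the geometry, and the number of its vectors
  leaves room for only one. If \<open>z\<^sub>1 + z\<^sub>2\<close> were on the line of \<open>\<chi> a\<close>, then \<open>z\<^sub>1\<close> and \<open>- z\<^sub>2\<close> would be two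
  such vectors of one coset.\<close>

lemma subspace_of_miso_AG:
  fixes \<chi> :: "'a \<Rightarrow> nat \<Rightarrow> 'f::{field,finite}"
  assumes r: "r \<ge> 1" and N: "simple_representation \<chi> N r"
    and iso: "miso N (AG r :: (nat \<Rightarrow> 'f) set mstruct)"
  shows "fvec.subspace (tuples r - vectors \<chi> N)" "tuples r - vectors \<chi> N \<subset> tuples r"
proof -
  let ?q = "int CARD('f)" and ?V = "tuples r :: (nat \<Rightarrow> 'f) set"
  define A where "A = vectors \<chi> N"
  have A: "A \<subseteq> ?V" "0 \<notin> A" using vectors_subset[OF N] by (auto simp: A_def)
  have finA: "finite A" using A(1) finite_subset finite_tuples by blast
  obtain f where f: "iso_map f N (AG r :: (nat \<Rightarrow> 'f) set mstruct)" using iso by (auto simp: miso_def)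
  then have "card (ground N) = card (ground (AG r :: (nat \<Rightarrow> 'f) set mstruct))"
    using bij_betw_same_card by (auto simp: iso_map_def)
  then have "card A = card {v \<in> tuples r. v 0 \<noteq> (0 :: 'f)}"
    unfolding A_def card_vectors[OF N] AG_vectors(2)[symmetric] card_vectors[OF AG_vectors(1)] by simp
  then have cA: "?q * int (card A) = (?q - 1) * int (card ?V)"
    using card_AG_vectors[OF r, where 'f = 'f] by (simp add: card_tuples)
  have q: "?q \<ge> 2" using card_field_ge_2[where 'f = 'f] by simp
  have Vpos: "card ?V > 0" by (simp add: card_tuples)
  have "card A \<noteq> 0"
  proof
    assume "card A = 0"
    then have "(?q - 1) * int (card ?V) = 0" using cA by simp
    then show False using q Vpos by simp
  qed
  then have "A \<noteq> {}" by auto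
  then show "tuples r - vectors \<chi> N \<subset> tuples r" using A by (auto simp: A_def)
  \<comment> \<open>Removing the span \<open>L\<close> of \<open>\<chi> a\<close> takes away q
    vectors, exactly q - 1 of them in \<open>A\<close>, so \<open>A\<close> still has density (q -
    1) / q on \<open>V - L\<close>. As every coset there loses at least one vector, each loses
    exactly one.\<close>
  have exact: "card {c. b + fscale c (\<chi> a) \<in> A} = CARD('f) - 1"
    if a: "a \<in> ground N" and b: "b \<in> ?V" "b \<noteq> 0" "b \<notin> line (\<chi> a)" for a b
  proof -
    define L where "L = insert 0 (line (\<chi> a))"
    have \<chi>a: "\<chi> a \<in> ?V" "\<chi> a \<noteq> 0" using N a by (auto simp: simple_representation_def)
    have LV: "L \<subseteq> ?V" using line_subset_tuples[OF \<chi>a(1)] by (auto simp: L_def)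
    have L_eq: "L = range (\<lambda>c. fscale c (\<chi> a))"
      by (auto simp: L_def line_def)
    have cL: "card L = CARD('f)"
      unfolding L_eq using \<chi>a by (subst card_image) (auto simp: inj_on_def)
    have shift: "v + fscale c (\<chi> a) \<in> L \<longleftrightarrow> v \<in> L" for v c
    proof
      assume "v \<in> L" then show "v + fscale c (\<chi> a) \<in> L"
        unfolding L_eq by (auto simp flip: fvec.scale_left_distrib)
    next
      assume "v + fscale c (\<chi> a) \<in> L"
      then obtain d where "v + fscale c (\<chi> a) = fscale d (\<chi> a)" unfolding L_eq by auto
      then have "v = fscale (d - c) (\<chi> a)" by (simp add: fvec.scale_left_diff_distrib eq_diff_eq)
      then show "v \<in> L" unfolding L_eq by auto
    qed
    have le: "card {c. v + fscale c (\<chi> a) \<in> A} \<le> CARD('f) - 1" if v: "v \<in> ?V - L" for v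
    proof -
      obtain c where "v + fscale c (\<chi> a) \<notin> A"
        using miso_AG_no_full_line[OF N iso a, of v] v by (auto simp: A_def L_def)
      then have "{c. v + fscale c (\<chi> a) \<in> A} \<subseteq> UNIV - {c}" by blast
      then have "card {c. v + fscale c (\<chi> a) \<in> A} \<le> card (UNIV - {c})" by (intro card_mono) auto
      then show ?thesis by simp
    qed
    have lA: "line (\<chi> a) \<subseteq> A" using a by (auto simp: A_def vectors_def)
    have cAL: "int (card (A - L)) = int (card A) - (?q - 1)"
    proof -
      have "A - L = A - line (\<chi> a)" using A(2) by (auto simp: L_def)
      then show ?thesis
        using lA finA card_mono[OF finA lA] q card_line[OF \<chi>a(2)] by (simp add: card_Diff_subset of_nat_diff)
    qed
    have cVL: "int (card (?V - L)) = int (card ?V) - ?q"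
      using LV card_mono[OF finite_tuples LV] cL by (simp add: card_Diff_subset finite_subset[OF LV] of_nat_diff)
    \<comment> \<open>Summing over all vectors counts each coset q times, which avoids choosing
      coset representatives.\<close>
    have "(\<Sum>v\<in>?V - L. int (card {c. v + fscale c (\<chi> a) \<in> A})) =
        (\<Sum>v\<in>?V - L. \<Sum>c\<in>UNIV. if v + fscale c (\<chi> a) \<in> A then 1 else 0)"
      by (intro sum.cong refl) (simp add: sum.If_cases)
    also have "\<dots> = (\<Sum>c\<in>UNIV. \<Sum>v\<in>?V - L. if v + fscale c (\<chi> a) \<in> A then 1 else 0)"
      by (rule sum.swap)
    also have "\<dots> = (\<Sum>c\<in>(UNIV :: 'f set). int (card (A - L)))"
    proof (intro sum.cong refl)
      fix c :: 'f
      have "bij_betw (\<lambda>v. v + fscale c (\<chi> a)) {v \<in> ?V - L. v + fscale c (\<chi> a) \<in> A} (A - L)"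
      proof (rule bij_betw_byWitness[where f' = "\<lambda>v. v + fscale (- c) (\<chi> a)"])
        show "(\<lambda>v. v + fscale (- c) (\<chi> a)) ` (A - L) \<subseteq> {v \<in> ?V - L. v + fscale c (\<chi> a) \<in> A}"
        proof
          fix w assume "w \<in> (\<lambda>v. v + fscale (- c) (\<chi> a)) ` (A - L)"
          then obtain v where v: "v \<in> A - L" "w = v + fscale (- c) (\<chi> a)" by blast
          have "w \<in> ?V" unfolding v(2) using v A \<chi>a by (intro tuples_add tuples_fscale) auto
          moreover have "w \<notin> L" using v shift by blast
          moreover have "w + fscale c (\<chi> a) = v" using v by simp
          ultimately show "w \<in> {v \<in> ?V - L. v + fscale c (\<chi> a) \<in> A}" using v by simp
        qed
      qed (use shift in auto)
      then have "card {v \<in> ?V - L. v + fscale c (\<chi> a) \<in> A} = card (A - L)" by (rule bij_betw_same_card)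
      then show "(\<Sum>v\<in>?V - L. if v + fscale c (\<chi> a) \<in> A then 1 else 0) = int (card (A - L))"
        by (subst sum.inter_filter[symmetric]) simp_all
    qed
    also have "\<dots> = ?q * int (card (A - L))" by simp
    also have "\<dots> = (?q - 1) * int (card (?V - L))"
      unfolding cAL cVL using cA by (simp add: algebra_simps)
    finally have "(\<Sum>v\<in>?V - L. ?q - 1 - int (card {c. v + fscale c (\<chi> a) \<in> A})) = 0"
      by (simp add: sum_subtractf)
    moreover have "?q - 1 - int (card {c. v + fscale c (\<chi> a) \<in> A}) \<ge> 0" if "v \<in> ?V - L" for v
      using le[OF that] q by linarith
    ultimately have "\<forall>v\<in>?V - L. ?q - 1 - int (card {c. v + fscale c (\<chi> a) \<in> A}) = 0"
      by (subst (asm) sum_nonneg_eq_0_iff) auto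
    moreover have "b \<in> ?V - L" using b by (simp add: L_def)
    ultimately have "?q - 1 - int (card {c. b + fscale c (\<chi> a) \<in> A}) = 0" by blast
    then show ?thesis using q by linarith
  qed
  have neg: "z1 + z2 \<notin> A" if z: "z1 \<in> ?V - A" "z2 \<in> ?V - A" for z1 z2
  proof
    assume "z1 + z2 \<in> A"
    then obtain a where a: "a \<in> ground N" "z1 + z2 \<in> line (\<chi> a)" by (auto simp: A_def vectors_def)
    then obtain d where d: "d \<noteq> 0" "z1 + z2 = fscale d (\<chi> a)" by (auto simp: line_def)
    have "line (\<chi> a) \<subseteq> A" using a by (auto simp: A_def vectors_def)
    then have "z1 \<notin> line (\<chi> a)" using z by blast
    moreover have "z1 \<noteq> 0" using z \<open>z1 + z2 \<in> A\<close> by auto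
    ultimately have c: "card {c. z1 + fscale c (\<chi> a) \<in> A} = CARD('f) - 1"
      using exact[OF a(1), of z1] z by blast
    have "fscale (- 1) z2 \<notin> A" using z vectors_fscale_iff[of "- 1 :: 'f" z2 \<chi> N] unfolding A_def by auto
    \<comment> \<open>The coset of \<open>z1\<close> thus misses \<open>A\<close> at the two
      distinct parameters 0 and \<open>- d\<close>, where only one miss is possible.\<close>
    moreover have "z1 + fscale (- d) (\<chi> a) = fscale (- 1) z2"
      using d(2) by (simp add: algebra_simps)
    ultimately have "{c. z1 + fscale c (\<chi> a) \<in> A} \<subseteq> UNIV - {0, - d}" using z by auto
    then have "card {c. z1 + fscale c (\<chi> a) \<in> A} \<le> card (UNIV - {0, - d})" by (intro card_mono) auto
    also have "\<dots> = CARD('f) - 2" using d(1) by (simp add: card_Diff_subset)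
    finally show False using c card_field_ge_2[where 'f = 'f] by simp
  qed
  show "fvec.subspace (tuples r - vectors \<chi> N)"
    unfolding fvec.subspace_def
  proof (intro conjI ballI allI)
    show "0 \<in> tuples r - vectors \<chi> N" using A by (simp add: A_def)
    show "x + y \<in> tuples r - vectors \<chi> N"
      if "x \<in> tuples r - vectors \<chi> N" "y \<in> tuples r - vectors \<chi> N" for x y
      using that neg[of x y] tuples_add[of x r y] unfolding A_def by blast
    show "fscale c x \<in> tuples r - vectors \<chi> N" if "x \<in> tuples r - vectors \<chi> N" for c x
      using that A(2) vectors_fscale_iff[of c x \<chi> N] tuples_fscale[of x r c]
      by (cases "c = 0") (auto simp: A_def)
  qed
qed

text \<open>A linear change of coordinates turns the functional \<open>u\<close> into coordinate 0,
  so that the occupied points off its hyperplane become the points of \<open>AG r\<close>.\<close>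

lemma miso_AG_of_functional:
  fixes \<psi> :: "'a \<Rightarrow> nat \<Rightarrow> 'f::{field,finite}"
  assumes M: "represents \<psi> M" and im: "\<psi> ` ground M \<subseteq> tuples r"
    and u: "u \<in> tuples r" "u \<noteq> 0"
    and hit: "\<And>v. v \<in> tuples r \<Longrightarrow> dot r u v \<noteq> 0 \<Longrightarrow> \<exists>e\<in>ground M. \<psi> e \<in> line v"
  shows "miso (si (mrestrict M {e \<in> ground M. dot r u (\<psi> e) \<noteq> 0})) (AG r :: (nat \<Rightarrow> 'f) set mstruct)"
proof -
  let ?X = "{e \<in> ground M. dot r u (\<psi> e) \<noteq> 0}" and ?V = "tuples r :: (nat \<Rightarrow> 'f) set"
  obtain j where j: "j < r" "u j \<noteq> 0" using tuples_nonzeroE[OF u] .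
  \<comment> \<open>Slot 0 receives the functional and the old coordinate 0 moves to slot
    \<open>j\<close>. The overwritten coordinate \<open>j\<close> can be recovered from the
    functional since \<open>u j\<close> is nonzero.\<close>
  define L where "L = (\<lambda>v i. if i = 0 then dot r u v else if i = j then v 0 else v i)"
  have Ladd: "L (v + w) = L v + L w" for v w by (auto simp: L_def dot_add_right)
  have Lscale: "L (fscale c v) = fscale c (L v)" for c v
    by (auto simp: L_def dot_fscale_right fscale_apply)
  have LV: "L v \<in> ?V" if "v \<in> ?V" for v using that j by (auto simp: L_def tuples_def)
  have L0: "v = 0" if "v \<in> ?V" "L v = 0" for v
  proof -
    have others: "v i = 0" if "i \<noteq> j" for i
      using fun_cong[OF \<open>L v = 0\<close>, of i] fun_cong[OF \<open>L v = 0\<close>, of j] that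
      by (cases "i = 0") (auto simp: L_def split: if_splits)
    have "0 = dot r u v" using fun_cong[OF that(2), of 0] by (simp add: L_def)
    also have "\<dots> = (\<Sum>i<r. if i = j then u j * v j else 0)"
      unfolding dot_def by (intro sum.cong) (auto simp: others)
    also have "\<dots> = u j * v j" using j by simp
    finally have "v j = 0" using j by simp
    then show "v = 0" using others by (auto simp: fun_eq_iff) (metis)
  qed
  have inj: "inj_on L ?V"
  proof (rule inj_onI)
    fix v w assume vw: "v \<in> ?V" "w \<in> ?V" "L v = L w"
    have "L (v + fscale (- 1) w) = 0" unfolding Ladd Lscale vw(3) by simp
    moreover have "v + fscale (- 1) w \<in> ?V" using vw by (intro tuples_add tuples_fscale)
    ultimately show "v = w" using L0[of "v + fscale (- 1) w"] by simp
  qed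
  have surj: "L ` ?V = ?V" using endo_inj_surj[OF finite_tuples _ inj] LV by blast
  define K where "K = the_inv_into ?V L"
  have K: "K w \<in> ?V" "L (K w) = w" if "w \<in> ?V" for w
    using that surj inj unfolding K_def by (auto simp: the_inv_into_into f_the_inv_into_f)
  have Lline: "line (L v) = line (L w)" if vw: "line v = line w" for v w
  proof -
    obtain a where "a \<noteq> 0" "v = fscale a w" using vw unfolding line_eq_iff by (auto simp: line_def)
    then show ?thesis by (simp add: Lscale)
  qed
  define N where "N = mrestrict M ?X"
  have gN: "ground N = ?X" by (auto simp: N_def mrestrict_def)
  have "represents (\<lambda>e. L (\<psi> e)) N"
    unfolding represents_def
  proof (intro conjI allI)
    have N0: "represents \<psi> N" unfolding N_def by (rule represents_mrestrict[OF M])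
    show fin: "finite (ground N)" by (rule represents_finite[OF N0])
    fix X
    have "indep_family (\<lambda>e. L (\<psi> e)) X \<longleftrightarrow> indep_family \<psi> X" if X: "X \<subseteq> ground N"
      using indep_family_linear[OF finite_subset[OF X fin] subspace_tuples[of r], of \<psi> L] X im gN
        Ladd Lscale L0 by (auto simp: o_def)
    then show "indep N X \<longleftrightarrow> X \<subseteq> ground N \<and> indep_family (\<lambda>e. L (\<psi> e)) X"
      by (auto simp: represents_indep[OF N0])
  qed
  moreover have "(\<lambda>e. L (\<psi> e)) ` ground N \<subseteq> ?V" using im LV gN by auto
  ultimately obtain \<phi> where \<phi>: "membedding \<phi> (si N) (PG r)"
    "\<phi> ` ground (si N) = {line (L (\<psi> e)) | e. e \<in> ground N \<and> L (\<psi> e) \<noteq> 0}"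
    using ex_embedding[of "\<lambda>e. L (\<psi> e)" N r] by blast
  have "ground (PG r) \<inter> \<phi> ` ground (si N) = ground (PG r) \<inter> {p. \<forall>v\<in>p. v 0 \<noteq> (0 :: 'f)}" (is "?A = ?B")
  proof
    show "?A \<subseteq> ?B"
    proof
      fix p assume p: "p \<in> ?A"
      then obtain e where e: "p = line (L (\<psi> e))" "e \<in> ground N" using \<phi>(2) by auto
      then have "L (\<psi> e) 0 \<noteq> 0" by (simp add: gN L_def)
      then show "p \<in> ?B" using p e(1) line_coord_nonzero by blast
    qed
    show "?B \<subseteq> ?A"
    proof
      fix p assume p: "p \<in> ?B"
      then obtain w where w: "p = line w" "w \<in> ?V" "w 0 \<noteq> 0" using line_coord_nonzero unfolding PG_ground by blast
      have "dot r u (K w) = w 0" using K(2)[OF w(2)] by (metis L_def)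
      then have d: "dot r u (K w) \<noteq> 0" using w(3) by simp
      then obtain e where e: "e \<in> ground M" "\<psi> e \<in> line (K w)" using hit[OF K(1)[OF w(2)]] by blast
      have lin: "line (L (\<psi> e)) = p" using Lline[of "\<psi> e" "K w"] e(2) K(2)[OF w(2)] w(1)
        by (simp add: line_eq)
      have "e \<in> ground N" using e d dot_line[OF e(2)] by (simp add: gN)
      moreover have "L (\<psi> e) \<noteq> 0"
      proof
        assume "L (\<psi> e) = 0"
        then have "p = {0}" using lin by simp
        then show False using w by (metis line_self singletonD zero_fun_apply)
      qed
      ultimately have "p \<in> \<phi> ` ground (si N)" unfolding \<phi>(2) using lin by blast
      then show "p \<in> ?A" using p by blast
    qed
  qed
  then have "mrestrict (PG r) (\<phi> ` ground (si N)) = AG r"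
    unfolding AG_def by (rule mrestrict_cong[OF represents_PG])
  then have "iso_map \<phi> (si N) (AG r)" using \<phi>(1) by (simp add: membedding_def)
  then show ?thesis unfolding N_def miso_def by blast
qed

text \<open>The given columns may be longer than the rank; they are rewritten in coordinates of
  their span, whose dimension is the rank.\<close>

lemma ex_embedding_of_representable:
  fixes M :: "'a mstruct"
  assumes mat: "matroid M" and rep: "representable_over TYPE('f::{field,finite}) M"
  shows "\<exists>(\<psi> :: 'a \<Rightarrow> nat \<Rightarrow> 'f) \<phi>. represents \<psi> M \<and>
    membedding \<phi> (si M) (PG (mrank M) :: (nat \<Rightarrow> 'f) set mstruct)"
proof -
  obtain n and \<psi> :: "'a \<Rightarrow> nat \<Rightarrow> 'f" where im: "\<psi> ` ground M \<subseteq> tuples n"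
    and ind: "\<And>X. X \<subseteq> ground M \<Longrightarrow> indep M X \<longleftrightarrow> indep_family \<psi> X"
    using rep by (auto simp: representable_over_def indep_family_def)
  have M: "represents \<psi> M"
    using ind matroid.finite_ground[OF mat] matroid.indep_subset_ground[OF mat]
    unfolding represents_def by blast
  let ?S = "fvec.span (\<psi> ` ground M)"
  obtain D where D: "D \<subseteq> \<psi> ` ground M" "fvec.independent D" "\<psi> ` ground M \<subseteq> fvec.span D"
    using fvec.maximal_independent_subset by blast
  have finD: "finite D" using D(1) represents_finite[OF M] by (meson finite_surj)
  obtain B where B: "B \<subseteq> ground M" "inj_on \<psi> B" "\<psi> ` B = D"
    using D(1) unfolding subset_image_inj by blast
  have "indep M B" using B D(2) by (simp add: represents_indep[OF M] indep_family_def)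
  then have le: "card D \<le> mrank M" using mrank_attained(2)[OF mat] B by (metis card_image)
  obtain X where X: "indep M X" "card X = mrank M" using mrank_attained(1)[OF mat] by blast
  then have X': "X \<subseteq> ground M" "inj_on \<psi> X" "fvec.independent (\<psi> ` X)"
    by (auto simp: represents_indep[OF M] indep_family_def)
  have finX: "finite (\<psi> ` X)" using X'(1) represents_finite[OF M] by (meson finite_imageI finite_subset)
  have "fvec.span (\<psi> ` X) \<subseteq> fvec.span D"
    using X'(1) D(3) by (intro fvec.span_minimal fvec.subspace_span) auto
  moreover have "finite (fvec.span D)"
    by (rule card_ge_0_finite) (simp add: card_span[OF D(2) finD])
  ultimately have "card (fvec.span (\<psi> ` X)) \<le> card (fvec.span D)" by (intro card_mono)
  then have "mrank M \<le> card D"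
    using card_field_ge_2[where 'f = 'f] X X'
    by (simp add: card_span[OF D(2) finD] card_span[OF X'(3) finX] card_image)
  then have cD: "card D = mrank M" using le by simp
  obtain b where b: "indep_family b {..<mrank M}" "b ` {..<mrank M} = D"
    using finite_indep_enum[OF D(2) finD] cD by metis
  have bij: "bij_betw (combine b (mrank M)) (tuples (mrank M)) (fvec.span D)"
    using combine_bij[OF b(1)] b(2) by simp
  let ?c = "the_inv_into (tuples (mrank M)) (combine b (mrank M))"
  obtain \<phi> where "membedding \<phi> (si M) (PG (mrank M) :: (nat \<Rightarrow> 'f) set mstruct)"
    "\<phi> ` ground (si M) = {line (?c (\<psi> e)) | e. e \<in> ground M \<and> ?c (\<psi> e) \<noteq> 0}"
    using ex_embedding[OF represents_coordinates[OF M b(1) bij D(3)]] .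
  then show ?thesis using M by blast
qed

text \<open>The span of \<open>Z\<close> and \<open>v\<close> in a form that shows its vectors off
  \<open>Z\<close> as \<open>Z\<close>-translates of nonzero multiples of \<open>v\<close>, on which
  an invariant weight is constant.\<close>

lemma subspace_add_line:
  fixes Z :: "(nat \<Rightarrow> 'f::{field,finite}) set"
  assumes Z: "fvec.subspace Z" "Z \<subseteq> tuples r" and v: "v \<in> tuples r" "v \<notin> Z"
  defines "S \<equiv> {fscale c v + z | c z. z \<in> Z}"
  shows "fvec.subspace S" "S \<subseteq> tuples r" "card S = CARD('f) * card Z" "Z \<subseteq> S" "\<And>c. fscale c v \<in> S"
proof -
  show "fvec.subspace S"
    unfolding fvec.subspace_def
  proof (intro conjI ballI allI)
    show "0 \<in> S" unfolding S_def using fvec.subspace_0[OF Z(1)]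
      by (metis (mono_tags, lifting) CollectI add.right_neutral fvec.scale_zero_left)
    show "x + y \<in> S" if xy: "x \<in> S" "y \<in> S" for x y
    proof -
      obtain c z d t where "x = fscale c v + z" "y = fscale d v + t" "z \<in> Z" "t \<in> Z"
        using xy by (auto simp: S_def)
      then have "x + y = fscale (c + d) v + (z + t)" "z + t \<in> Z"
        using fvec.subspace_add[OF Z(1)] by (simp_all add: fvec.scale_left_distrib)
      then show ?thesis unfolding S_def by blast
    qed
    show "fscale a x \<in> S" if x: "x \<in> S" for a x
    proof -
      obtain c z where "x = fscale c v + z" "z \<in> Z" using x by (auto simp: S_def)
      then have "fscale a x = fscale (a * c) v + fscale a z" "fscale a z \<in> Z"
        using fvec.subspace_scale[OF Z(1)] by (simp_all add: fvec.scale_right_distrib)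
      then show ?thesis unfolding S_def by blast
    qed
  qed
  show "S \<subseteq> tuples r" using Z v unfolding S_def by (auto intro!: tuples_add tuples_fscale)
  have "inj_on (\<lambda>(c, z). fscale c v + z) (UNIV \<times> Z)"
  proof (rule inj_onI, clarsimp)
    fix c z d t assume zt: "z \<in> Z" "t \<in> Z" and eq: "fscale c v + z = fscale d v + t"
    have diff: "fscale (c - d) v = t - z"
      using eq by (simp add: fvec.scale_left_diff_distrib algebra_simps)
    have "c = d"
    proof (rule ccontr)
      assume "c \<noteq> d"
      then have "v = fscale (1 / (c - d)) (t - z)" unfolding diff[symmetric] by simp
      moreover have "t - z \<in> Z" using fvec.subspace_diff[OF Z(1)] zt by blast
      ultimately have "v \<in> Z" using fvec.subspace_scale[OF Z(1)] by metis
      then show False using v by blast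
    qed
    then show "c = d \<and> z = t" using eq by simp
  qed
  then have "card ((\<lambda>(c, z). fscale c v + z) ` (UNIV \<times> Z)) = CARD('f) * card Z"
    by (simp add: card_image card_cartesian_product)
  moreover have "(\<lambda>(c, z). fscale c v + z) ` (UNIV \<times> Z) = S" by (auto simp: S_def)
  ultimately show "card S = CARD('f) * card Z" by simp
  show "Z \<subseteq> S"
  proof
    fix z assume "z \<in> Z"
    moreover have "z = fscale 0 v + z" by simp
    ultimately show "z \<in> S" unfolding S_def by blast
  qed
  show "fscale c v \<in> S" for c
  proof -
    have "fscale c v = fscale c v + 0" by simp
    then show ?thesis unfolding S_def using fvec.subspace_0[OF Z(1)] by blast
  qed
qed

section \<open>Equality in the cogirth bound\<close>

text \<open>\<open>\<psi>0\<close> is any representation of \<open>M\<close>, while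
  \<open>\<phi>\<close> is the embedding named in the theorem; the two need not be related.\<close>

locale embedded_matroid =
  fixes M :: "'a mstruct" and r :: nat and \<psi>0 :: "'a \<Rightarrow> nat \<Rightarrow> 'f::{field,finite}"
    and \<phi> :: "'a set \<Rightarrow> (nat \<Rightarrow> 'f) set"
  assumes mat: "matroid M" and rank: "mrank M = r" and r: "r \<ge> 1"
    and rep0: "represents \<psi>0 M" and emb: "membedding \<phi> (si M) (PG r)"
    and not_onto: "\<phi> ` ground (si M) \<noteq> ground (PG r)"
begin

abbreviation "E \<equiv> ground M"

text \<open>The representation compatible with \<open>\<phi>\<close>: each nonloop is placed on the
  point that \<open>\<phi>\<close> assigns to its class.\<close>

definition "\<psi> e = (if \<psi>0 e = 0 then 0 else point_vector (\<phi> {f. parallel M e f}))"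

lemma rep: "represents \<psi> M"
proof -
  have "represents (\<lambda>C. \<psi>0 (SOME e. e \<in> C)) (si M)"
    using class_nonempty[OF rep0] represents_class(3)[OF rep0] by (intro represents_si[OF rep0]) blast
  then have "represents (point_vector \<circ> \<phi>) (si M)"
    using represents_embedding[OF emb represents_PG] represents_subset by blast
  from represents_of_si[OF rep0 this] show ?thesis by (simp only: \<psi>_def[abs_def] o_apply)
qed

lemma fin: "finite E"
  by (rule represents_finite[OF rep])

lemma \<phi>_line:
  assumes "C \<in> parallel_classes M" "e \<in> C"
  shows "line (\<psi> e) = \<phi> C" "\<psi> e \<in> tuples r"
proof -
  have "\<phi> C \<in> ground (PG r)" using emb assms by (auto simp: membedding_def)
  then obtain v where v: "\<phi> C = line v" "v \<in> tuples r" by (auto simp: PG_ground)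
  have "\<psi> e = point_vector (\<phi> C)"
    using represents_class(2,4)[OF rep0 assms] by (simp add: \<psi>_def)
  then show l: "line (\<psi> e) = \<phi> C" using v by (simp add: line_point_vector)
  then show "\<psi> e \<in> tuples r" using v line_subset_tuples[OF v(2)] by (metis line_self subsetD)
qed

lemma im: "\<psi> ` E \<subseteq> tuples r"
proof
  fix v assume "v \<in> \<psi> ` E"
  then obtain e where e: "e \<in> E" "v = \<psi> e" by blast
  show "v \<in> tuples r"
  proof (cases "\<psi>0 e = 0")
    case True then show ?thesis using e by (simp add: \<psi>_def)
  next
    case False then show ?thesis using \<phi>_line(2)[OF class_of[OF rep0 e(1)]] e by simp
  qed
qed

lemma \<phi>_image: "\<phi> ` parallel_classes M = {line (\<psi> e) | e. e \<in> E \<and> \<psi> e \<noteq> 0}"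
proof
  show "\<phi> ` parallel_classes M \<subseteq> {line (\<psi> e) | e. e \<in> E \<and> \<psi> e \<noteq> 0}"
  proof
    fix p assume "p \<in> \<phi> ` parallel_classes M"
    then obtain C where C: "C \<in> parallel_classes M" "p = \<phi> C" by blast
    have e: "(SOME e. e \<in> C) \<in> C" by (rule class_nonempty[OF rep C(1)])
    show "p \<in> {line (\<psi> e) | e. e \<in> E \<and> \<psi> e \<noteq> 0}"
      using \<phi>_line(1)[OF C(1) e] represents_class(1,2)[OF rep C(1) e] C(2) by blast
  qed
  show "{line (\<psi> e) | e. e \<in> E \<and> \<psi> e \<noteq> 0} \<subseteq> \<phi> ` parallel_classes M"
    using \<phi>_line(1)[OF class_of[OF rep]] class_of(1)[OF rep] by blast
qed

section \<open>Weights, element counts and the bound\<close>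

definition "m u = card {e \<in> E. dot r u (\<psi> e) \<noteq> 0}"
text \<open>The size of the parallel class at the point of \<open>v\<close>, or 0 if that point is
  missing. Excluding zero vectors keeps loops from being counted at v = 0.\<close>

definition "w v = int (card {e \<in> E. \<psi> e \<noteq> 0 \<and> \<psi> e \<in> line v})"

sublocale projective_weight r w
proof
  show "w 0 = 0" by (simp add: w_def)
  show "w (fscale c v) = w v" if "c \<noteq> 0" for c v using that by (simp add: w_def)
qed

lemma w_eq_0_iff: "w v = 0 \<longleftrightarrow> v = 0 \<or> line v \<notin> \<phi> ` ground (si M)"
proof -
  have "w v = 0 \<longleftrightarrow> {e \<in> E. \<psi> e \<noteq> 0 \<and> \<psi> e \<in> line v} = {}"
    using fin by (simp add: w_def card_eq_0_iff)
  also have "\<dots> \<longleftrightarrow> (\<forall>e\<in>E. \<psi> e \<noteq> 0 \<longrightarrow> line (\<psi> e) \<noteq> line v)"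
    by (auto simp: line_eq_iff)
  also have "\<dots> \<longleftrightarrow> v = 0 \<or> line v \<notin> \<phi> ` ground (si M)"
    by (auto simp: \<phi>_image)
  finally show ?thesis .
qed

lemma w_card:
  assumes "C \<in> parallel_classes M" "v \<in> \<phi> C"
  shows "w v = int (card C)"
proof -
  have e: "(SOME e. e \<in> C) \<in> C" by (rule class_nonempty[OF rep assms(1)])
  let ?e = "SOME e. e \<in> C"
  have lv: "line v = line (\<psi> ?e)" using \<phi>_line(1)[OF assms(1) e] assms(2) line_eq by metis
  have "C = {f \<in> E. line (\<psi> f) = line (\<psi> ?e)}" by (rule represents_class(3)[OF rep assms(1) e])
  also have "\<dots> = {f \<in> E. \<psi> f \<noteq> 0 \<and> \<psi> f \<in> line v}"
    using represents_class(2)[OF rep assms(1) e] lv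
    by (auto simp: line_eq_iff[symmetric])
  finally show ?thesis by (simp add: w_def)
qed

text \<open>A nonloop is counted once at each of the q - 1 vectors of its line, on which
  \<open>P\<close> is constant.\<close>

lemma sum_w:
  assumes "\<And>v u. v \<in> line u \<Longrightarrow> P v \<longleftrightarrow> P u"
  shows "sum w {v \<in> V. P v} = (int CARD('f) - 1) * int (card {e \<in> E. \<psi> e \<noteq> 0 \<and> P (\<psi> e)})"
proof -
  let ?E = "{e \<in> E. \<psi> e \<noteq> 0}"
  have "sum w {v \<in> V. P v} = (\<Sum>v\<in>{v \<in> V. P v}. sum (\<lambda>_. 1) {e \<in> ?E. \<psi> e \<in> line v})"
    by (simp add: w_def conj_assoc)
  also have "\<dots> = (\<Sum>e\<in>?E. int (card {v \<in> {v \<in> V. P v}. \<psi> e \<in> line v}))"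
    using fin by (subst sum_swap_Collect) auto
  also have "\<dots> = (\<Sum>e\<in>?E. if P (\<psi> e) then int CARD('f) - 1 else 0)"
  proof (intro sum.cong refl)
    fix e assume e: "e \<in> ?E"
    have "{v \<in> {v \<in> V. P v}. \<psi> e \<in> line v} = (if P (\<psi> e) then line (\<psi> e) else {})"
    proof -
      have sym: "\<psi> e \<in> line v \<longleftrightarrow> v \<in> line (\<psi> e)" for v by (metis line_eq_iff)
      have inV: "v \<in> V" "P v \<longleftrightarrow> P (\<psi> e)" if "v \<in> line (\<psi> e)" for v
        using that assms[OF that] im e line_subset_tuples[of "\<psi> e" r] by auto
      have "{v \<in> {v \<in> V. P v}. v \<in> line (\<psi> e)} = (if P (\<psi> e) then line (\<psi> e) else {})"
      proof (cases "P (\<psi> e)")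
        case True then show ?thesis unfolding if_P[OF True] using inV by blast
      next
        case False then show ?thesis unfolding if_not_P[OF False] using inV by blast
      qed
      then show ?thesis by (simp only: sym)
    qed
    then show "int (card {v \<in> {v \<in> V. P v}. \<psi> e \<in> line v}) = (if P (\<psi> e) then int CARD('f) - 1 else 0)"
      using e card_line[of "\<psi> e"] card_field_ge_2[where 'f = 'f] by (simp add: of_nat_diff)
  qed
  also have "\<dots> = (\<Sum>e\<in>{e \<in> ?E. P (\<psi> e)}. int CARD('f) - 1)"
    using fin by (subst sum.inter_filter) auto
  finally show ?thesis by (simp add: conj_assoc mult.commute)
qed

text \<open>Loops lie in no hyperplane complement, so the bound holds with this smaller count; the
  gap to \<open>card E\<close> is what forces looplessness in case of equality.\<close>

definition "W = card {e \<in> E. \<psi> e \<noteq> 0}"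

lemma total_weight: "total_weight = (int CARD('f) - 1) * int W"
  using sum_w[of "\<lambda>_. True"] by (simp add: total_weight_def W_def)

lemma defect: "defect u = (int CARD('f) - 1) * ((int CARD('f) - 1) * int W - int CARD('f) * int (m u))"
proof -
  have "{e \<in> E. \<psi> e \<noteq> 0} = {e \<in> E. \<psi> e \<noteq> 0 \<and> dot r u (\<psi> e) = 0} \<union> {e \<in> E. dot r u (\<psi> e) \<noteq> 0}"
    by auto
  then have "W = card {e \<in> E. \<psi> e \<noteq> 0 \<and> dot r u (\<psi> e) = 0} + m u"
    unfolding W_def m_def using fin by (simp only:) (subst card_Un_disjoint; auto)
  then have "int (card {e \<in> E. \<psi> e \<noteq> 0 \<and> dot r u (\<psi> e) = 0}) = int W - int (m u)" by simp
  moreover have "sum w {v \<in> V. dot r u v = 0} =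
      (int CARD('f) - 1) * int (card {e \<in> E. \<psi> e \<noteq> 0 \<and> dot r u (\<psi> e) = 0})"
    by (rule sum_w) (rule dot_line)
  ultimately have "sum w {v \<in> V. dot r u v = 0} = (int CARD('f) - 1) * (int W - int (m u))" by simp
  then show ?thesis unfolding defect_def total_weight by (simp only:) (simp add: algebra_simps)
qed

lemma defect_sign:
  "defect u \<ge> 0 \<longleftrightarrow> CARD('f) * m u \<le> (CARD('f) - 1) * W" "defect u \<le> 0 \<longleftrightarrow> (CARD('f) - 1) * W \<le> CARD('f) * m u"
  "defect u = 0 \<longleftrightarrow> (CARD('f) - 1) * W = CARD('f) * m u"
proof -
  have q: "int CARD('f) - 1 > 0" using card_field_ge_2[where 'f = 'f] by simp
  have "(int CARD('f) - 1) * int W = int ((CARD('f) - 1) * W)" using q by (simp add: of_nat_diff)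
  then have d: "defect u = (int CARD('f) - 1) * (int ((CARD('f) - 1) * W) - int (CARD('f) * m u))"
    unfolding defect by simp
  show "defect u \<ge> 0 \<longleftrightarrow> CARD('f) * m u \<le> (CARD('f) - 1) * W" "defect u \<le> 0 \<longleftrightarrow> (CARD('f) - 1) * W \<le> CARD('f) * m u"
    "defect u = 0 \<longleftrightarrow> (CARD('f) - 1) * W = CARD('f) * m u"
    unfolding d using q by (simp_all only: zero_le_mult_iff mult_le_0_iff mult_eq_0_iff) linarith+
qed

lemma W_le: "W \<le> card E"
  unfolding W_def using fin by (intro card_mono) auto

lemma W_eq_iff: "W = card E \<longleftrightarrow> loopless M"
proof -
  have "W = card E \<longleftrightarrow> {e \<in> E. \<psi> e \<noteq> 0} = E"
    unfolding W_def using fin card_subset_eq[of E "{e \<in> E. \<psi> e \<noteq> 0}"] by auto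
  then show ?thesis by (auto simp: loopless_def represents_mloop[OF rep])
qed

lemma cogirth_le_m: "u \<in> V \<Longrightarrow> u \<noteq> 0 \<Longrightarrow> cogirth M \<le> m u"
  unfolding m_def by (rule cogirth_le[OF mat rank rep im])

lemma cogirth_eq_m: "\<exists>u\<in>V. u \<noteq> 0 \<and> m u \<le> cogirth M"
  unfolding m_def using cogirth_attained[OF mat rank rep im r] by metis

lemma cogirth_positive: "cogirth M > 0"
  by (rule cogirth_pos[OF mat rank rep im r])

lemma ex_missing: "\<exists>x\<in>V. x \<noteq> 0 \<and> w x = 0"
proof -
  have "\<phi> ` ground (si M) \<subseteq> ground (PG r)" using emb by (simp add: membedding_def)
  then obtain p where "p \<in> ground (PG r)" "p \<notin> \<phi> ` ground (si M)" using not_onto by blast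
  then show ?thesis unfolding w_eq_0_iff PG_ground by blast
qed

lemma cogirth_bound: "CARD('f) * cogirth M \<le> (CARD('f) - 1) * W"
proof -
  obtain x where "x \<in> V" "x \<noteq> 0" "w x = 0" using ex_missing by blast
  then obtain u where u: "u \<in> V" "u \<noteq> 0" "defect u \<ge> 0" using ex_defect_nonneg by blast
  then have "CARD('f) * cogirth M \<le> CARD('f) * m u" using cogirth_le_m[OF u(1,2)] by simp
  from this u(3)[unfolded defect_sign] show ?thesis by (rule order_trans)
qed

lemma inequality: "CARD('f) * cogirth M \<le> (CARD('f) - 1) * card E"
  using cogirth_bound W_le by (meson le_trans mult_le_mono2)

section \<open>Missing vectors and translation invariance\<close>

definition "Z = {v \<in> V. w v = 0}"

abbreviation "missing \<equiv> ground (PG r) - \<phi> ` ground (si M)"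

lemma missing_iff: "p \<in> ground (PG r) \<Longrightarrow> p \<in> missing \<longleftrightarrow> p \<subseteq> Z"
proof -
  assume p: "p \<in> ground (PG r)"
  then obtain v where v: "p = line v" "v \<in> V" "v \<noteq> 0" by (auto simp: PG_ground)
  have "p \<in> missing \<longleftrightarrow> w v = 0" using p v by (simp add: w_eq_0_iff)
  also have "\<dots> \<longleftrightarrow> p \<subseteq> Z"
    using v line_subset_tuples[OF v(2)] line_self[of v] by (auto simp: Z_def line_def w_fscale)
  finally show ?thesis .
qed

lemma Z_eq: "Z = insert 0 (\<Union> missing)"
proof
  show "Z \<subseteq> insert 0 (\<Union> missing)"
  proof
    fix v assume v: "v \<in> Z"
    show "v \<in> insert 0 (\<Union> missing)"
    proof (cases "v = 0")
      case False
      then have "line v \<in> missing" using v by (auto simp: Z_def w_eq_0_iff PG_ground)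
      then show ?thesis using line_self by blast
    qed simp
  qed
  show "insert 0 (\<Union> missing) \<subseteq> Z" using missing_iff by (auto simp: Z_def w_zero)
qed

lemma restrict_missing: "mrestrict (PG r) missing = mrestrict (PG r) {p. p \<subseteq> Z}"
  by (rule mrestrict_cong[OF represents_PG]) (use missing_iff in blast)

lemma Z_sub: "Z \<subseteq> V"
  by (auto simp: Z_def)

text \<open>The hinge of the characterisation: it is derived from equality as well as from (i) and
  (ii), and it implies (i) and (ii) for a suitable k.\<close>

definition "invariant \<longleftrightarrow> (\<forall>v\<in>V. \<forall>z\<in>Z. w (v + z) = w v)"

lemma invariant_subspace:
  assumes "invariant"
  shows "fvec.subspace Z"
  unfolding fvec.subspace_def
proof (intro conjI ballI allI)
  show "0 \<in> Z" by (simp add: Z_def w_zero)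
  show "x + y \<in> Z" if "x \<in> Z" "y \<in> Z" for x y
    using assms that unfolding invariant_def by (auto simp: Z_def)
  show "fscale c x \<in> Z" if "x \<in> Z" for c x
    using that by (cases "c = 0") (auto simp: Z_def w_zero w_fscale)
qed

abbreviation "flat_condition k \<equiv>
  miso (mrestrict (PG r) missing) (PG k :: (nat \<Rightarrow> 'f) set mstruct) \<and>
  (\<forall>P \<subseteq> ground (PG r).
    miso (mrestrict (PG r) P) (PG (k + 1) :: (nat \<Rightarrow> 'f) set mstruct) \<and> missing \<subseteq> P \<longrightarrow>
    (\<forall>C\<in>ground (si M). \<forall>D\<in>ground (si M). \<phi> C \<in> P \<and> \<phi> D \<in> P \<longrightarrow> card C = card D))"

lemma card_le_iff:
  assumes "X \<subseteq> E"
  shows "(CARD('f) - 1) * card (E - X) \<le> card X \<longleftrightarrow> (CARD('f) - 1) * card E \<le> CARD('f) * card X"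
proof -
  have "card E = card X + card (E - X)"
    using assms fin by (metis card_Diff_subset card_mono finite_subset le_add_diff_inverse)
  moreover have "CARD('f) = Suc (CARD('f) - 1)" using card_field_ge_2[where 'f = 'f] by simp
  then have "CARD('f) * card X = card X + (CARD('f) - 1) * card X" by (metis mult_Suc)
  ultimately show ?thesis by (simp add: add_mult_distrib2)
qed

text \<open>Equality squeezes \<open>W\<close> up to \<open>card E\<close>. Then no hyperplane
  complement is smaller than the average, so all defects are nonpositive and the invariance
  applies.\<close>

lemma equality_imp:
  assumes eq: "CARD('f) * cogirth M = (CARD('f) - 1) * card E"
  shows "loopless M" "invariant"
proof -
  have "(CARD('f) - 1) * card E \<le> (CARD('f) - 1) * W" using cogirth_bound eq by simp
  then have W: "W = card E" using W_le card_field_ge_2[where 'f = 'f] by simp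
  then show "loopless M" by (simp add: W_eq_iff)
  have "defect u \<le> 0" if "u \<in> V" "u \<noteq> 0" for u
  proof -
    have "CARD('f) * cogirth M \<le> CARD('f) * m u" using cogirth_le_m[OF that] by simp
    then show ?thesis using eq W by (simp add: defect_sign)
  qed
  then show "invariant" using weight_invariant by (auto simp: invariant_def Z_def)
qed

text \<open>Here k is the dimension of the subspace \<open>Z\<close> of missing vectors.\<close>

lemma flats_of_invariant:
  assumes inv: "invariant"
  shows "\<exists>k. 1 \<le> k \<and> k < r \<and> flat_condition k"
proof -
  have sZ: "fvec.subspace Z" by (rule invariant_subspace[OF inv])
  obtain k where k: "card Z = CARD('f) ^ k" using subspace_coordinates[OF sZ Z_sub] by metis
  have q: "CARD('f) \<ge> 2" by (rule card_field_ge_2)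
  have finZ: "finite Z" using Z_sub finite_tuples by (rule finite_subset)
  have "k \<ge> 1"
  proof (rule ccontr)
    assume "\<not> k \<ge> 1"
    then have "card Z = 1" using k by (simp add: not_less_eq_eq)
    moreover obtain x where "x \<noteq> 0" "x \<in> Z" using ex_missing by (auto simp: Z_def)
    moreover have "0 \<in> Z" by (simp add: Z_def w_zero)
    ultimately show False by (metis card_1_singletonE singletonD)
  qed
  moreover have "k < r"
  proof -
    \<comment> \<open>If all elements were loops, the bound in terms of \<open>W\<close> would make
      the positive cogirth zero.\<close>
    have "W > 0"
    proof (rule ccontr)
      assume "\<not> W > 0"
      then show False using cogirth_bound cogirth_positive q by simp
    qed
    then obtain e where e: "e \<in> E" "\<psi> e \<noteq> 0" unfolding W_def by (auto simp: card_gt_0_iff)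
    then have "line (\<psi> e) \<in> \<phi> ` ground (si M)" by (auto simp: \<phi>_image)
    then have "\<psi> e \<notin> Z" using e by (simp add: Z_def w_eq_0_iff)
    then have "Z \<subset> V" using Z_sub im e by blast
    then have "card Z < card V" by (intro psubset_card_mono) auto
    then show ?thesis using k q by (simp add: card_tuples)
  qed
  moreover have "miso (mrestrict (PG r) missing) (PG k :: (nat \<Rightarrow> 'f) set mstruct)"
    unfolding restrict_missing by (rule miso_PG_of_subspace[OF sZ Z_sub k])
  moreover have "card C = card D"
    if P: "P \<subseteq> ground (PG r)" "miso (mrestrict (PG r) P) (PG (k + 1) :: (nat \<Rightarrow> 'f) set mstruct)"
      "missing \<subseteq> P" and CD: "C \<in> parallel_classes M" "D \<in> parallel_classes M" "\<phi> C \<in> P" "\<phi> D \<in> P"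
    for P C D
  proof -
    define S where "S = insert 0 (\<Union> P)"
    have "vectors point_vector (mrestrict (PG r) P) = \<Union> P"
      using P(1) by (simp add: simple_representation_PG(2) Int_absorb1)
    then have cS: "card S = CARD('f) ^ (k + 1)"
      using subspace_of_miso_PG(2)[OF simple_representation_PG(1) P(2)] by (simp add: S_def)
    have sS: "fvec.subspace S"
      using subspace_of_miso_PG(1)[OF simple_representation_PG(1) P(2)]
        \<open>vectors point_vector (mrestrict (PG r) P) = \<Union> P\<close> by (simp add: S_def)
    have finS: "finite S"
      using cS q by (intro card_ge_0_finite) simp
    define e f where "e = (SOME e. e \<in> C)" and "f = (SOME e. e \<in> D)"
    have e: "e \<in> C" and f: "f \<in> D" unfolding e_def f_def by (rule class_nonempty[OF rep], fact)+
    have le: "line (\<psi> e) = \<phi> C" "\<psi> e \<in> V" "line (\<psi> f) = \<phi> D" "\<psi> f \<in> V"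
      using \<phi>_line[OF CD(1) e] \<phi>_line[OF CD(2) f] by auto
    have "\<psi> e \<noteq> 0" "\<psi> f \<noteq> 0" using represents_class(2)[OF rep] CD e f by auto
    then have nZ: "\<psi> e \<notin> Z" "\<psi> f \<notin> Z" using le CD by (auto simp: Z_def w_eq_0_iff)
    have inS: "\<psi> e \<in> S" "\<psi> f \<in> S" using le CD line_self unfolding S_def by blast+
    have ZS: "Z \<subseteq> S" using P(3) by (auto simp: Z_eq S_def)
    \<comment> \<open>The span of \<open>Z\<close> and \<open>\<psi> e\<close> has as many vectors
      as the flat \<open>S\<close> containing it, so \<open>\<psi> f\<close> is a multiple of
      \<open>\<psi> e\<close> translated by a missing vector, and both have the same weight.\<close>
    let ?T = "{fscale c (\<psi> e) + z | c z. z \<in> Z}"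
    have "?T \<subseteq> S"
      using ZS inS(1) by (auto intro!: fvec.subspace_add[OF sS] fvec.subspace_scale[OF sS])
    moreover have "card ?T = card S"
      using subspace_add_line(3)[OF sZ Z_sub le(2) nZ(1)] cS k by simp
    ultimately have "?T = S" using finS by (intro card_subset_eq)
    then obtain c z where cz: "\<psi> f = fscale c (\<psi> e) + z" "z \<in> Z" using inS(2) by blast
    have c: "c \<noteq> 0" using cz nZ(2) by auto
    have "w (\<psi> f) = w (fscale c (\<psi> e))"
      unfolding cz(1) using inv cz(2) le(2) unfolding invariant_def by blast
    also have "\<dots> = w (\<psi> e)" using c by (rule w_fscale)
    finally have "w (\<psi> f) = w (\<psi> e)" .
    moreover have "\<psi> e \<in> \<phi> C" "\<psi> f \<in> \<phi> D" using le line_self by metis+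
    ultimately show ?thesis using w_card[OF CD(1), of "\<psi> e"] w_card[OF CD(2), of "\<psi> f"] by simp
  qed
  ultimately show ?thesis unfolding si_ground by blast
qed

text \<open>The vectors outside an affine geometry form a proper subspace, so some functional kills
  them. All elements off its hyperplane lie in \<open>X\<close>, which therefore has at least
  cogirth many elements.\<close>

lemma affine_of_equality:
  assumes eq: "CARD('f) * cogirth M = (CARD('f) - 1) * card E"
  shows "(\<forall>X \<subseteq> E. (\<forall>C\<in>parallel_classes M. C \<subseteq> X \<or> C \<inter> X = {}) \<and>
    miso (si (mrestrict M X)) (AG r :: (nat \<Rightarrow> 'f) set mstruct) \<longrightarrow>
    card X \<ge> (CARD('f) - 1) * card (E - X))"
proof (intro allI impI, elim conjE)
  fix X assume X: "X \<subseteq> E" and cl: "\<forall>C\<in>parallel_classes M. C \<subseteq> X \<or> C \<inter> X = {}"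
    and iso: "miso (si (mrestrict M X)) (AG r :: (nat \<Rightarrow> 'f) set mstruct)"
  define N where "N = si (mrestrict M X)"
  have N: "N = mrestrict (si M) {C. C \<subseteq> X}"
    unfolding N_def using cl by (intro si_mrestrict[OF rep]) blast
  have gN: "ground N = {C \<in> parallel_classes M. C \<subseteq> X}" by (auto simp: N mrestrict_def)
  have si: "represents (point_vector \<circ> \<phi>) (si M)"
  proof (rule represents_si[OF rep])
    fix C e assume "C \<in> parallel_classes M" "e \<in> C"
    then show "line ((point_vector \<circ> \<phi>) C) = line (\<psi> e)"
      using \<phi>_line(1) by (metis comp_apply line_point_vector)
  qed
  have lin: "line (point_vector (\<phi> C)) = \<phi> C \<and> point_vector (\<phi> C) \<in> V - {0}"
    if C: "C \<in> parallel_classes M" for C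
  proof -
    define e where "e = (SOME e. e \<in> C)"
    have e: "e \<in> C" unfolding e_def by (rule class_nonempty[OF rep C])
    have l: "line (\<psi> e) = \<phi> C" "\<psi> e \<in> V" "\<psi> e \<noteq> 0"
      using \<phi>_line[OF C e] represents_class(2)[OF rep C e] by auto
    then have l': "line (point_vector (\<phi> C)) = \<phi> C" by (metis line_point_vector)
    then have "point_vector (\<phi> C) \<in> line (\<psi> e)" using l(1) by (metis line_self)
    moreover from this have "point_vector (\<phi> C) \<noteq> 0" using l(3) by (metis zero_in_line_iff)
    ultimately show ?thesis using l' line_subset_tuples[OF l(2)] by blast
  qed
  have inj: "inj_on \<phi> (parallel_classes M)"
    using emb by (auto simp: membedding_def iso_map_def bij_betw_def)
  have simple: "simple_representation (point_vector \<circ> \<phi>) N r"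
    unfolding simple_representation_def
  proof (intro conjI)
    show "represents (point_vector \<circ> \<phi>) N" unfolding N by (rule represents_mrestrict[OF si])
    show "(point_vector \<circ> \<phi>) ` ground N \<subseteq> V - {0}" using lin by (auto simp: gN)
    show "inj_on (\<lambda>x. line ((point_vector \<circ> \<phi>) x)) (ground N)"
      using lin inj by (auto simp: gN inj_on_def)
  qed
  have isoN: "miso N (AG r :: (nat \<Rightarrow> 'f) set mstruct)" using iso by (simp add: N_def)
  obtain u where u: "u \<in> V" "u \<noteq> 0" "\<And>v. v \<in> V - vectors (point_vector \<circ> \<phi>) N \<Longrightarrow> dot r u v = 0"
    using ex_orthogonal[OF subspace_of_miso_AG[OF r simple isoN]] by metis
  have "{e \<in> E. dot r u (\<psi> e) \<noteq> 0} \<subseteq> X"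
  proof
    fix e assume e: "e \<in> {e \<in> E. dot r u (\<psi> e) \<noteq> 0}"
    then have "\<psi> e \<in> vectors (point_vector \<circ> \<phi>) N" using u(3)[of "\<psi> e"] im by auto
    then obtain C where C: "C \<in> parallel_classes M" "C \<subseteq> X" "\<psi> e \<in> line (point_vector (\<phi> C))"
      by (auto simp: vectors_def gN)
    then have l: "line (\<psi> e) = \<phi> C" using lin line_eq by metis
    define f where "f = (SOME e. e \<in> C)"
    have f: "f \<in> C" unfolding f_def by (rule class_nonempty[OF rep C(1)])
    have "e \<in> C"
      unfolding represents_class(3)[OF rep C(1) f] using e l \<phi>_line(1)[OF C(1) f] by simp
    then show "e \<in> X" using C by blast
  qed
  then have "m u \<le> card X"
    unfolding m_def using X fin by (intro card_mono) (auto intro: finite_subset)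
  then have "cogirth M \<le> card X" using cogirth_le_m[OF u(1,2)] by simp
  then have "CARD('f) * cogirth M \<le> CARD('f) * card X" by simp
  then show "(CARD('f) - 1) * card (E - X) \<le> card X" unfolding card_le_iff[OF X] eq .
qed

text \<open>A vector \<open>v\<close> outside \<open>Z\<close> and its translate
  \<open>v + z\<close> lie in the same flat one dimension above \<open>Z\<close>, where (ii) equates
  their class sizes.\<close>

lemma invariant_of_flats:
  assumes k: "flat_condition k"
  shows "invariant"
proof -
  have v: "vectors point_vector (mrestrict (PG r) missing) = \<Union> missing"
    unfolding simple_representation_PG(2) by (simp add: Int_absorb1)
  have sZ: "fvec.subspace Z" and cZ: "card Z = CARD('f) ^ k"
    unfolding Z_eq using subspace_of_miso_PG[OF simple_representation_PG(1) conjunct1[OF k]]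
    by (simp_all only: v)
  have "w (v + z) = w v" if v: "v \<in> V" and z: "z \<in> Z" for v z
  proof (cases "v \<in> Z")
    case True
    then have "v + z \<in> Z" using z fvec.subspace_add[OF sZ] by blast
    then show ?thesis using True by (simp add: Z_def)
  next
    case False
    have zV: "z \<in> V" using z Z_sub by blast
    have vzV: "v + z \<in> V" using v zV by blast
    have vz: "v + z \<notin> Z"
    proof
      assume "v + z \<in> Z"
      then have "v + z - z \<in> Z" using fvec.subspace_diff[OF sZ] z by blast
      then show False using False by simp
    qed
    define S where "S = {fscale c v + z | c z. z \<in> Z}"
    note S = subspace_add_line[OF sZ Z_sub v False, folded S_def]
    define P where "P = {p \<in> ground (PG r). p \<subseteq> S}"
    have "mrestrict (PG r) P = mrestrict (PG r) {p. p \<subseteq> S}"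
      by (rule mrestrict_cong[OF represents_PG]) (auto simp: P_def)
    moreover have "card S = CARD('f) ^ (k + 1)" using S(3) cZ by simp
    ultimately have iso: "miso (mrestrict (PG r) P) (PG (k + 1) :: (nat \<Rightarrow> 'f) set mstruct)"
      using miso_PG_of_subspace[OF S(1,2)] by metis
    have mP: "missing \<subseteq> P" using S(4) missing_iff by (auto simp: P_def)
    have vS: "v \<in> S" using S(5)[of 1] by simp
    have vzS: "v + z \<in> S" using fvec.subspace_add[OF S(1) vS] z S(4) by blast
    have lineS: "line x \<in> P" if x: "x \<in> S" "x \<notin> Z" for x
    proof -
      have "x \<noteq> 0" using x(2) by (auto simp: Z_def w_zero)
      moreover have "line x \<subseteq> S" using fvec.subspace_scale[OF S(1) x(1)] by (auto simp: line_def)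
      ultimately show ?thesis using S(2) x(1) by (auto simp: P_def PG_ground)
    qed
    have cls: "\<exists>C\<in>ground (si M). \<phi> C = line x" if x: "x \<in> V" "x \<notin> Z" for x
      using x by (auto simp: Z_def w_eq_0_iff)
    obtain C where C: "C \<in> ground (si M)" "\<phi> C = line v" using cls[OF v False] by blast
    obtain D where D: "D \<in> ground (si M)" "\<phi> D = line (v + z)" using cls[OF vzV vz] by blast
    have "card C = card D"
      using k iso mP C D lineS[OF vS False] lineS[OF vzS vz] P_def by (metis (no_types, lifting) mem_Collect_eq subsetI)
    then show ?thesis using w_card[of C v] w_card[of D "v + z"] C D line_self by simp
  qed
  then show ?thesis by (simp add: invariant_def)
qed

text \<open>Some \<open>m u\<close> is at most the cogirth, so it suffices to bound every
  \<open>m u\<close> from below by the average.\<close>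

lemma equality_of:
  assumes ll: "loopless M" and inv: "invariant" and aff: "(\<forall>X \<subseteq> E. (\<forall>C\<in>parallel_classes M. C \<subseteq> X \<or> C \<inter> X = {}) \<and>
    miso (si (mrestrict M X)) (AG r :: (nat \<Rightarrow> 'f) set mstruct) \<longrightarrow>
    card X \<ge> (CARD('f) - 1) * card (E - X))"
  shows "CARD('f) * cogirth M = (CARD('f) - 1) * card E"
proof -
  have W: "W = card E" using ll by (simp add: W_eq_iff)
  have ge: "(CARD('f) - 1) * card E \<le> CARD('f) * m u" if u: "u \<in> V" "u \<noteq> 0" for u
  proof (cases "\<exists>z\<in>Z. dot r u z \<noteq> 0")
    case True
    then obtain z where "z \<in> Z" "dot r u z \<noteq> 0" by blast
    then have "defect u = 0"
      using inv by (intro defect_zero_if_invariant[of z]) (auto simp: invariant_def Z_def)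
    then show ?thesis using W by (simp add: defect_sign)
  next
    case False
    \<comment> \<open>All missing vectors lie on this hyperplane, so every point off it is occupied
      and the elements off it restrict to an affine geometry.\<close>
    define X where "X = {e \<in> E. dot r u (\<psi> e) \<noteq> 0}"
    have "C \<subseteq> X \<or> C \<inter> X = {}" if C: "C \<in> parallel_classes M" for C
    proof (cases "C \<inter> X = {}")
      case False
      then obtain e where e: "e \<in> C" "e \<in> X" by blast
      have "C \<subseteq> X"
      proof
        fix f assume f: "f \<in> C"
        have "\<psi> f \<in> line (\<psi> e)" using \<phi>_line(1)[OF C e(1)] \<phi>_line(1)[OF C f] by (metis line_self)
        then show "f \<in> X" using e represents_class(1)[OF rep C f] dot_line by (auto simp: X_def)
      qed
      then show ?thesis ..
    qed simp
    moreover have "miso (si (mrestrict M X)) (AG r :: (nat \<Rightarrow> 'f) set mstruct)"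
      unfolding X_def
    proof (rule miso_AG_of_functional[OF rep im u])
      fix v assume v: "v \<in> V" "dot r u v \<noteq> 0"
      then have "v \<notin> Z" using False by blast
      then have "line v \<in> \<phi> ` ground (si M)" using v by (simp add: Z_def w_eq_0_iff)
      then obtain e where e: "e \<in> E" "line v = line (\<psi> e)" unfolding si_ground \<phi>_image by blast
      then show "\<exists>e\<in>E. \<psi> e \<in> line v" by auto
    qed
    moreover have XE: "X \<subseteq> E" by (auto simp: X_def)
    ultimately have "(CARD('f) - 1) * card (E - X) \<le> card X" using aff by blast
    then show ?thesis unfolding card_le_iff[OF XE] by (simp add: X_def m_def)
  qed
  obtain u where u: "u \<in> V" "u \<noteq> 0" "m u \<le> cogirth M" using cogirth_eq_m by blast
  have "CARD('f) * m u \<le> CARD('f) * cogirth M" using u(3) by simp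
  with ge[OF u(1,2)] inequality show ?thesis by linarith
qed

lemma equality_iff:
  "CARD('f) * cogirth M = (CARD('f) - 1) * card E \<longleftrightarrow>
    loopless M \<and> (\<exists>k. 1 \<le> k \<and> k < r \<and> flat_condition k) \<and>
    (\<forall>X \<subseteq> E. (\<forall>C\<in>parallel_classes M. C \<subseteq> X \<or> C \<inter> X = {}) \<and>
    miso (si (mrestrict M X)) (AG r :: (nat \<Rightarrow> 'f) set mstruct) \<longrightarrow>
    card X \<ge> (CARD('f) - 1) * card (E - X))"
  (is "?L \<longleftrightarrow> ?R")
proof
  assume eq: ?L
  show ?R
    using equality_imp[OF eq] flats_of_invariant affine_of_equality[OF eq] by blast
next
  assume ?R
  then show ?L
    using equality_of invariant_of_flats by blast
qed

lemma ratio: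
  "real (card E) / real (cogirth M) \<ge> real CARD('f) / (real CARD('f) - 1)"
  "real (card E) / real (cogirth M) = real CARD('f) / (real CARD('f) - 1) \<longleftrightarrow> CARD('f) * cogirth M = (CARD('f) - 1) * card E"
proof -
  have pos: "real (cogirth M) > 0" "real CARD('f) - 1 > 0"
    using cogirth_positive card_field_ge_2[where 'f = 'f] by auto
  have int: "real ((CARD('f) - 1) * card E) = (real CARD('f) - 1) * real (card E)"
    using card_field_ge_2[where 'f = 'f] by (simp add: of_nat_diff)
  have "real (CARD('f) * cogirth M) \<le> real ((CARD('f) - 1) * card E)" using inequality of_nat_le_iff by blast
  then have "real CARD('f) * real (cogirth M) \<le> (real CARD('f) - 1) * real (card E)" unfolding int by simp
  then show "real (card E) / real (cogirth M) \<ge> real CARD('f) / (real CARD('f) - 1)"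
    using pos by (simp add: field_simps)
  have "CARD('f) * cogirth M = (CARD('f) - 1) * card E \<longleftrightarrow> real (CARD('f) * cogirth M) = real ((CARD('f) - 1) * card E)"
    by (rule of_nat_eq_iff[symmetric])
  also have "\<dots> \<longleftrightarrow> real (card E) / real (cogirth M) = real CARD('f) / (real CARD('f) - 1)"
    unfolding int using pos by (simp add: field_simps) linarith
  finally show "real (card E) / real (cogirth M) = real CARD('f) / (real CARD('f) - 1) \<longleftrightarrow> CARD('f) * cogirth M = (CARD('f) - 1) * card E"
    by simp
qed

end

theorem theorem1p1:
  fixes M :: "'a mstruct" and q r :: nat
  assumes "primepow q" and "CARD('f::{field,finite}) = q"
    and "r \<ge> 1"
    and "matroid M" and "mrank M = r"
    and "representable_over TYPE('f) M"
    and "\<not> miso (si M) (PG r :: (nat \<Rightarrow> 'f) set mstruct)"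
  shows "real (card (ground M)) / real (cogirth M) \<ge> real q / (real q - 1) \<and>
    (\<forall>\<phi> :: 'a set \<Rightarrow> (nat \<Rightarrow> 'f) set. membedding \<phi> (si M) (PG r) \<longrightarrow>
      (real (card (ground M)) / real (cogirth M) = real q / (real q - 1) \<longleftrightarrow>
        loopless M \<and>
        (\<exists>k. 1 \<le> k \<and> k < r \<and>
          miso (mrestrict (PG r) (ground (PG r) - \<phi> ` ground (si M)))
            (PG k :: (nat \<Rightarrow> 'f) set mstruct) \<and>
          (\<forall>P \<subseteq> ground (PG r).
            miso (mrestrict (PG r) P) (PG (k + 1) :: (nat \<Rightarrow> 'f) set mstruct) \<and>
            ground (PG r) - \<phi> ` ground (si M) \<subseteq> P \<longrightarrow>
            (\<forall>C\<in>ground (si M). \<forall>D\<in>ground (si M).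
              \<phi> C \<in> P \<and> \<phi> D \<in> P \<longrightarrow> card C = card D))) \<and>
        (\<forall>X \<subseteq> ground M. (\<forall>C\<in>parallel_classes M. C \<subseteq> X \<or> C \<inter> X = {}) \<and>
          miso (si (mrestrict M X)) (AG r :: (nat \<Rightarrow> 'f) set mstruct) \<longrightarrow>
          card X \<ge> (q - 1) * card (ground M - X))))"
proof -
  \<comment> \<open>The inequality mentions no embedding, so one has to be produced; the
    characterisation is then proved for each given one with the same \<open>\<psi>0\<close>.\<close>
  obtain \<psi>0 :: "'a \<Rightarrow> nat \<Rightarrow> 'f" and \<phi>0 where rep: "represents \<psi>0 M"
    and emb: "membedding \<phi>0 (si M) (PG r :: (nat \<Rightarrow> 'f) set mstruct)"
    using ex_embedding_of_representable[OF assms(4,6)] assms(5) by blast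
  have embedded: "embedded_matroid M r \<psi>0 \<phi>"
    if "membedding \<phi> (si M) (PG r)" for \<phi> :: "'a set \<Rightarrow> (nat \<Rightarrow> 'f) set"
  proof -
    \<comment> \<open>An embedding onto the whole geometry would be an isomorphism of
      \<open>si M\<close> with \<open>PG r\<close>.\<close>
    have "\<phi> ` ground (si M) \<noteq> ground (PG r)"
      using assms(7) that mrestrict_ground[OF represents_subset[OF represents_PG]]
      unfolding membedding_def miso_def by metis
    then show ?thesis using assms rep that by (intro embedded_matroid.intro)
  qed
  show ?thesis
  proof (intro conjI allI impI)
    show "real (card (ground M)) / real (cogirth M) \<ge> real q / (real q - 1)"
      using embedded_matroid.ratio(1)[OF embedded[OF emb]] assms(2) by simp
  next
    fix \<phi> :: "'a set \<Rightarrow> (nat \<Rightarrow> 'f) set" assume "membedding \<phi> (si M) (PG r)"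
    then interpret embedded_matroid M r \<psi>0 \<phi> by (rule embedded)
    from ratio(2) equality_iff show "real (card (ground M)) / real (cogirth M) = real q / (real q - 1) \<longleftrightarrow>
        loopless M \<and>
        (\<exists>k. 1 \<le> k \<and> k < r \<and>
          miso (mrestrict (PG r) (ground (PG r) - \<phi> ` ground (si M)))
            (PG k :: (nat \<Rightarrow> 'f) set mstruct) \<and>
          (\<forall>P \<subseteq> ground (PG r).
            miso (mrestrict (PG r) P) (PG (k + 1) :: (nat \<Rightarrow> 'f) set mstruct) \<and>
            ground (PG r) - \<phi> ` ground (si M) \<subseteq> P \<longrightarrow>
            (\<forall>C\<in>ground (si M). \<forall>D\<in>ground (si M).
              \<phi> C \<in> P \<and> \<phi> D \<in> P \<longrightarrow> card C = card D))) \<and>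
        (\<forall>X \<subseteq> ground M. (\<forall>C\<in>parallel_classes M. C \<subseteq> X \<or> C \<inter> X = {}) \<and>
          miso (si (mrestrict M X)) (AG r :: (nat \<Rightarrow> 'f) set mstruct) \<longrightarrow>
          card X \<ge> (q - 1) * card (ground M - X))"
      unfolding assms(2) by (rule trans)
  qed
qed

end
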